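(* Let $F$ be a probability distribution function on $\mathbb{R}$ with $\overline F(t)=1-F(t)>0$ for all $t$, let $\psi(t)=-\log\overline F(t)$, and let $a=a_n(s)=\psi(s)-\log n$. Assume that $$\psi(t)=b(t)+\int_0^t\eta(u)\,du\qquad\text{for all }t\ge 0,$$ where $\eta(t)\downarrow 0$ as $t\to\infty$ and $b$ is measurable, bounded and satisfies $$\lim_{y\to 1,\;t\to\infty}\bigl(b(yt)-b(t)\bigr)=0 .$$ Suppose $t_n$ are constants increasing to $\infty$ and $\lambda\in(0,1)$ is such that, as $n\to\infty$, the following three conditions hold: $$\sup_{s\ge t_n}\ \inf_{w\ge s/a}\ n\left(\frac{|\mu_1(w)|+a\,\mu_2(w)/s}{s\wedge \frac{1}{\eta(\lambda s)}}+F(-w)\right)\to 0,$$ $$\sup_{s\ge t_n}\frac{1\vee\bigl(s\eta(\lambda s)\log (s\eta(\lambda s))\bigr)}{a}\to 0\qquad(\text{with } a=a_n(s)>0\text{ for all }s\ge t_n,\ n\text{ large}),$$ $$\sup_{s\ge t_n}\ n\bigl(1\vee s\eta(\lambda s)\bigr)\,\overline F(s/a)\to 0 .$$ Then $$\lim_{n\to\infty}\ \sup_{s\ge t_n}\left|\frac{P[S_n>s]}{n\overline F(s)}-1\right|=0 .$$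
   Context: $X_1,X_2,\dots$ are independent random variables each with distribution $F$, and $S_n=\sum_{i=1}^nX_i$. For $t>0$, $\mu_1(t)=\int_{|x|\le t}x\,dF(x)$ and $\mu_2(t)=\int_{|x|\le t}x^2\,dF(x)$. The notation $\eta(t)\downarrow0$ means $\eta$ is nonnegative, nonincreasing and tends to $0$ as $t\to\infty$; $\vee$ and $\wedge$ denote maximum and minimum. In the three conditions, $a$ stands for $a_n(s)$, depending on $n$ and $s$. *)

theory Defs
  imports "HOL-Probability.Probability"
begin

text \<open>
  Throughout, \<open>D\<close> is the law on the reals whose distribution function is \<open>F = cdf D\<close>.
\<close>

definition tail :: "real measure \<Rightarrow> real \<Rightarrow> real" where
  "tail D t = 1 - cdf D t"

definition psi :: "real measure \<Rightarrow> real \<Rightarrow> real" where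
  "psi D t = - ln (tail D t)"

definition a_fun :: "real measure \<Rightarrow> nat \<Rightarrow> real \<Rightarrow> real" where
  "a_fun D n s = psi D s - ln (real n)"

definition mu1 :: "real measure \<Rightarrow> real \<Rightarrow> real" where
  "mu1 D t = (LINT x:{x. \<bar>x\<bar> \<le> t}|D. x)"

definition mu2 :: "real measure \<Rightarrow> real \<Rightarrow> real" where
  "mu2 D t = (LINT x:{x. \<bar>x\<bar> \<le> t}|D. x\<^sup>2)"

text \<open>
  Only the values of \<open>\<eta>\<close> on the open half-line matter, and \<open>\<eta>\<close> may have an integrable
  singularity at the origin (Weibull-type tails: \<open>\<eta> u = \<beta> * u powr (\<beta> - 1)\<close> with
  \<open>0 < \<beta> < 1\<close>). Integrability is what makes the integral below meaningful, the Bochner integral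
  of a non-integrable function being 0.
  The function \<open>b\<close> is constrained on the closed half-line only. In its last condition
  \<open>nhds 1\<close> may be read as a punctured neighbourhood, the difference being 0 at \<open>y = 1\<close>.

  These conditions and \<open>0 < tail D t\<close> for all \<open>t\<close> force \<open>\<eta> > 0\<close> on the open half-line, because
  \<open>psi D\<close> tends to infinity while \<open>b\<close> is bounded. Hence \<open>1 / \<eta> u\<close> and
  \<open>ln (s * \<eta> u)\<close>, for positive \<open>u\<close> and \<open>s\<close>, never meet a zero argument.
\<close>

definition psi_representation ::
    "real measure \<Rightarrow> (real \<Rightarrow> real) \<Rightarrow> (real \<Rightarrow> real) \<Rightarrow> bool" where
  "psi_representation D b \<eta> \<longleftrightarrow>
     (\<forall>u>0. 0 \<le> \<eta> u) \<and> antimono_on {0<..} \<eta> \<and> (\<eta> \<longlongrightarrow> 0) at_top \<and>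
     b \<in> borel_measurable (restrict_space borel {0..}) \<and> bounded (b ` {0..}) \<and>
     ((\<lambda>(y, t). b (y * t) - b t) \<longlongrightarrow> 0) (nhds 1 \<times>\<^sub>F at_top) \<and>
     (\<forall>t\<ge>0. set_integrable lborel {0..t} \<eta> \<and> psi D t = b t + (LBINT u:{0..t}. \<eta> u))"

text \<open>
  The suprema and infima in the next three conditions are taken in the extended reals, so that
  an unbounded supremum is infinite. Only large \<open>n\<close> matter, for which \<open>t n\<close> and \<open>a_fun D n s\<close>
  are positive.
\<close>

definition moment_condition ::
    "real measure \<Rightarrow> (real \<Rightarrow> real) \<Rightarrow> real \<Rightarrow> (nat \<Rightarrow> real) \<Rightarrow> bool" where
  "moment_condition D \<eta> l t \<longleftrightarrow>
     (\<lambda>n. SUP s\<in>{t n..}. INF w\<in>{s / a_fun D n s..}.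
        ereal (real n * ((\<bar>mu1 D w\<bar> + a_fun D n s * mu2 D w / s) / min s (1 / \<eta> (l * s))
                          + cdf D (- w)))) \<longlonglongrightarrow> 0"

definition growth_condition ::
    "real measure \<Rightarrow> (real \<Rightarrow> real) \<Rightarrow> real \<Rightarrow> (nat \<Rightarrow> real) \<Rightarrow> bool" where
  "growth_condition D \<eta> l t \<longleftrightarrow>
     (\<forall>\<^sub>F n in sequentially. \<forall>s\<ge>t n. 0 < a_fun D n s) \<and>
     (\<lambda>n. SUP s\<in>{t n..}.
        ereal (max 1 (s * \<eta> (l * s) * ln (s * \<eta> (l * s))) / a_fun D n s)) \<longlonglongrightarrow> 0"

definition tail_condition ::
    "real measure \<Rightarrow> (real \<Rightarrow> real) \<Rightarrow> real \<Rightarrow> (nat \<Rightarrow> real) \<Rightarrow> bool" where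
  "tail_condition D \<eta> l t \<longleftrightarrow>
     (\<lambda>n. SUP s\<in>{t n..}.
        ereal (real n * max 1 (s * \<eta> (l * s)) * tail D (s / a_fun D n s))) \<longlonglongrightarrow> 0"

end

theory Submission
  imports Defs
begin

text \<open>
  Write \<open>K = 1 \<or> s \<eta>(l s)\<close> and \<open>r = s \<and> 1 / \<eta>(l s) = s / K\<close>, and recall \<open>n F'(s) = exp (- a)\<close> for the
  tail \<open>F'\<close>. The representation of \<open>\<psi>\<close> makes \<open>r\<close> the insensitivity scale of the tail:
  \<open>F'(s \<plusminus> \<rho> r) / F'(s)\<close> is close to 1 for small \<open>\<rho>\<close>, so that \<open>n F'(s - \<rho> r)\<close> accounts for the
  event that one summand exceeds \<open>s - \<rho> r\<close>. The growth condition gives \<open>K = o(a)\<close>, and all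
  other ways of exceeding \<open>s\<close> have probability \<open>o(exp (- a))\<close>:

  \<^item> two summands exceed \<open>l s\<close>: this costs \<open>(n F'(l s))^2\<close>, which is \<open>exp (- 2 a + O(K))\<close>;

  \<^item> no summand exceeds \<open>l s\<close>: Markov's inequality with exponent \<open>\<theta> = c a / s\<close>, \<open>1 < c < 1 / l\<close>.
    The moment condition controls the part of the exponential moment below \<open>s / a\<close>. Between
    \<open>s / a\<close> and \<open>l s\<close>, concavity of the integral of \<open>\<eta>\<close> together with \<open>n F'(s / a) \<le> 1\<close> and
    \<open>n F'(l s) \<le> exp (- a + O(K))\<close> yields \<open>n F'(u) = O(exp (- q a u / s))\<close> for any \<open>c < q < 1 / l\<close>,
    so this part contributes a bounded amount;

  \<^item> exactly one summand lies in \<open>(l s, s - \<rho> r]\<close>: the same inequality, using that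
    \<open>F'(u) \<le> F'(s) exp (O(1) + K (s - u) / s)\<close> there and \<open>\<theta> > K / s\<close>; the gap \<open>\<rho> r\<close> gains a factor
    \<open>exp (- const * a / K)\<close>.

  The matching lower bound comes from the disjoint events that a single summand exceeds
  \<open>s + \<rho> r\<close> while the others sum to more than \<open>- \<rho> r\<close>, by a truncated Chebyshev inequality.
\<close>

section \<open>Exponential moments of a distribution on the reals\<close>

text \<open>For \<open>x \<ge> 0\<close> this is the second-order Taylor formula. For
  \<open>x < 0\<close> the quadratic lower bound of \<open>exp (- x)\<close> is inverted, since
  \<open>1 + x + x\<^sup>2 / 2\<close> times \<open>1 - x + x\<^sup>2 / 2\<close> equals 1 plus a
  fourth power over 4. The constant depends only on the upper bound \<open>c\<close>, so arbitrarily
  negative \<open>x\<close> are covered.\<close>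

lemma exp_le_one_plus_quadratic:
  fixes x c :: real
  assumes "x \<le> c" "0 \<le> c"
  shows "exp x \<le> 1 + x + exp c * x\<^sup>2"
proof (cases "0 \<le> x")
  case True
  have "\<exists>t. \<bar>t\<bar> \<le> \<bar>x\<bar> \<and> exp x = (\<Sum>m<2. x ^ m / fact m) + exp t / fact 2 * x ^ 2"
    by (rule Maclaurin_exp_le)
  then obtain t where t: "\<bar>t\<bar> \<le> \<bar>x\<bar>" "exp x = 1 + x + exp t / 2 * x\<^sup>2"
    by (auto simp: numeral_2_eq_2)
  have "exp t / 2 \<le> exp c"
    using t(1) True assms by (smt (verit) exp_le_cancel_iff exp_gt_zero field_sum_of_halves)
  then have "exp t / 2 * x\<^sup>2 \<le> exp c * x\<^sup>2"
    by (rule mult_right_mono) simp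
  then show ?thesis
    using t(2) by simp
next
  case False
  have lower: "1 - x + x\<^sup>2 / 2 \<le> exp (- x)"
    using exp_lower_Taylor_quadratic[of "- x"] False by simp
  have pos: "0 < 1 - x + x\<^sup>2 / 2"
    using False by (smt (verit) zero_le_power2 half_gt_zero_iff divide_nonneg_pos)
  have "1 \<le> (1 + x + x\<^sup>2 / 2) * (1 - x + x\<^sup>2 / 2)"
  proof -
    have "(1 + x + x\<^sup>2 / 2) * (1 - x + x\<^sup>2 / 2) = 1 + (x\<^sup>2)\<^sup>2 / 4"
      by (simp add: algebra_simps power2_eq_square)
    then show ?thesis by simp
  qed
  then have "inverse (1 - x + x\<^sup>2 / 2) \<le> 1 + x + x\<^sup>2 / 2"
    using pos by (simp add: field_simps)
  moreover have "exp x \<le> inverse (1 - x + x\<^sup>2 / 2)"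
    using le_imp_inverse_le[OF lower pos] by (simp add: exp_minus)
  moreover have "x\<^sup>2 / 2 \<le> exp c * x\<^sup>2"
  proof -
    have "1 / 2 \<le> exp c"
      using one_le_exp_iff[of c] assms(2) by linarith
    then have "1 / 2 * x\<^sup>2 \<le> exp c * x\<^sup>2"
      by (rule mult_right_mono) simp
    then show ?thesis by simp
  qed
  ultimately show ?thesis by simp
qed

context real_distribution
begin

lemma tail_eq_measure: "tail M u = measure M {u<..}"
proof -
  have "measure M (space M - {..u}) = 1 - measure M {..u}"
    by (rule prob_compl) simp
  moreover have "space M - {..u} = {u<..}"
    by auto
  ultimately show ?thesis
    by (simp add: tail_def cdf_def)
qed

lemma tail_antimono: "u \<le> v \<Longrightarrow> tail M v \<le> tail M u"
  by (simp add: tail_def cdf_nondecreasing)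

lemma tail_nonneg: "0 \<le> tail M u"
  by (simp add: tail_eq_measure)

lemma mu2_nonneg: "0 \<le> mu2 M w"
  unfolding mu2_def set_lebesgue_integral_def by (rule integral_nonneg_AE) (simp add: indicator_def)

lemma set_integrable_exp_bounded:
  assumes "A \<in> sets borel" "\<And>x. x \<in> A \<Longrightarrow> x \<le> q" "0 \<le> \<theta>"
  shows "set_integrable M A (\<lambda>x. exp (\<theta> * x))"
  unfolding set_integrable_def
proof (rule integrable_const_bound[where B = "exp (\<theta> * q)"])
  show "AE x in M. norm (indicat_real A x *\<^sub>R exp (\<theta> * x)) \<le> exp (\<theta> * q)"
    using assms by (auto simp: indicator_def mult_left_mono)
qed (use assms in measurable)

text \<open>Integration by parts in Fubini form: \<open>exp (\<theta> * x)\<close> is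
  \<open>exp (\<theta> * p)\<close> plus the integral of
  \<open>\<theta> * exp (\<theta> * u)\<close> over \<open>{p..x}\<close>; after exchanging
  integrals the mass of \<open>{u<..q}\<close> is bounded by the tail at \<open>u\<close>. Both
  signs of \<open>\<theta> - \<kappa>\<close> occur later: negative in
  \<open>truncated_mgf_power_le\<close>, positive in \<open>big_jump_integral_le\<close>.\<close>

lemma exp_integral_le_of_tail_le:
  fixes p q A \<theta> \<kappa> :: real
  assumes "p \<le> q" "0 < \<theta>" "\<theta> \<noteq> \<kappa>"
    and tail_le: "\<And>u. p \<le> u \<Longrightarrow> u \<le> q \<Longrightarrow> tail M u \<le> A * exp (- \<kappa> * u)"
  shows "(LINT x:{p<..q}|M. exp (\<theta> * x))
    \<le> A * (exp ((\<theta> - \<kappa>) * p) + \<theta> * (exp ((\<theta> - \<kappa>) * q) - exp ((\<theta> - \<kappa>) * p)) / (\<theta> - \<kappa>))"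
    (is "_ \<le> ?R")
proof -
  have "0 \<le> A * exp (- \<kappa> * p)"
    using tail_le[of p] tail_nonneg[of p] \<open>p \<le> q\<close> by simp
  then have A: "0 \<le> A"
    by (simp add: zero_le_mult_iff)
  \<comment> \<open>Antiderivative of \<open>\<theta> * A * exp ((\<theta> - \<kappa>) * u)\<close>,
    the integrand left after Fubini. Its monotonicity is read off the derivative, so that no case
    distinction on the sign of \<open>\<theta> - \<kappa>\<close> arises.\<close>
  let ?F = "\<lambda>u. \<theta> * A / (\<theta> - \<kappa>) * exp ((\<theta> - \<kappa>) * u)"
  have F_mono: "?F p \<le> ?F q"
  proof -
    have *: "mono ?F"
    proof (rule monoI)
      fix u v :: real assume "u \<le> v"
      show "?F u \<le> ?F v"
      proof (rule DERIV_nonneg_imp_nondecreasing[OF \<open>u \<le> v\<close>])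
        fix x
        have "(?F has_real_derivative \<theta> * A * exp ((\<theta> - \<kappa>) * x)) (at x)"
          using assms by (auto intro!: derivative_eq_intros)
        then show "\<exists>y. (?F has_real_derivative y) (at x) \<and> 0 \<le> y"
          using A \<open>0 < \<theta>\<close> by (intro exI[of _ "\<theta> * A * exp ((\<theta> - \<kappa>) * x)"]) auto
      qed
    qed
    show ?thesis using monoD[OF * \<open>p \<le> q\<close>] .
  qed
  have R_eq: "A * exp ((\<theta> - \<kappa>) * p) + (?F q - ?F p) = ?R"
    by (simp add: ring_distribs diff_divide_distrib mult_ac)
  interpret P: pair_sigma_finite M lborel ..
  \<comment> \<open>The double integrand lives on the triangle \<open>p \<le> u < x \<le> q\<close>.
    The strict inequality produces the mass of \<open>{u<..q}\<close> and differs from the closed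
    interval in \<open>inner\<close> only on a null set.\<close>
  let ?h = "\<lambda>(x, u). ennreal (\<theta> * exp (\<theta> * u)) * indicator {p..q} u * indicator {z. fst z > snd z \<and> fst z \<le> q} (x, u)"
  have h_meas: "?h \<in> borel_measurable (M \<Otimes>\<^sub>M lborel)"
    by measurable
  have inner: "(\<integral>\<^sup>+u. ?h (x, u) \<partial>lborel) = ennreal (exp (\<theta> * x) - exp (\<theta> * p))"
    if "p < x" "x \<le> q" for x
  proof -
    have "(\<integral>\<^sup>+u. ?h (x, u) \<partial>lborel)
        = (\<integral>\<^sup>+u. ennreal (\<theta> * exp (\<theta> * u)) * indicator {p..x} u \<partial>lborel)"
      using AE_lborel_singleton[of x] that
      by (intro nn_integral_cong_AE) (auto elim!: eventually_mono simp: indicator_def)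
    also have "\<dots> = exp (\<theta> * x) - exp (\<theta> * p)"
      using that \<open>0 < \<theta>\<close>
      by (intro nn_integral_FTC_Icc) (auto intro!: derivative_eq_intros)
    finally show ?thesis .
  qed
  have "(\<integral>\<^sup>+x. ennreal (indicator {p<..q} x * exp (\<theta> * x)) \<partial>M)
      \<le> (\<integral>\<^sup>+x. ennreal (exp (\<theta> * p)) * indicator {p<..q} x + (\<integral>\<^sup>+u. ?h (x, u) \<partial>lborel) \<partial>M)"
  proof (rule nn_integral_mono)
    fix x
    show "ennreal (indicator {p<..q} x * exp (\<theta> * x))
      \<le> ennreal (exp (\<theta> * p)) * indicator {p<..q} x + (\<integral>\<^sup>+u. ?h (x, u) \<partial>lborel)"
    proof (cases "p < x \<and> x \<le> q")
      case True
      have "exp (\<theta> * p) \<le> exp (\<theta> * x)"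
        using True \<open>0 < \<theta>\<close> by simp
      then show ?thesis
        using True inner[of x] by (simp flip: ennreal_plus)
    qed auto
  qed
  also have "\<dots> = ennreal (exp (\<theta> * p)) * emeasure M {p<..q}
      + (\<integral>\<^sup>+x. (\<integral>\<^sup>+u. ?h (x, u) \<partial>lborel) \<partial>M)"
    using h_meas by (subst nn_integral_add) (auto intro!: lborel.borel_measurable_nn_integral simp: nn_integral_cmult_indicator)
  also have "(\<integral>\<^sup>+x. (\<integral>\<^sup>+u. ?h (x, u) \<partial>lborel) \<partial>M)
      = (\<integral>\<^sup>+u. (\<integral>\<^sup>+x. ?h (x, u) \<partial>M) \<partial>lborel)"
    using P.Fubini'[OF h_meas] by simp
  also have "\<dots> = (\<integral>\<^sup>+u. ennreal (\<theta> * exp (\<theta> * u)) * indicator {p..q} u * emeasure M {u<..q} \<partial>lborel)"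
  proof (rule nn_integral_cong)
    fix u
    have "(\<integral>\<^sup>+x. ?h (x, u) \<partial>M)
        = (\<integral>\<^sup>+x. (ennreal (\<theta> * exp (\<theta> * u)) * indicator {p..q} u) * indicator {u<..q} x \<partial>M)"
      by (rule nn_integral_cong) (auto simp: indicator_def)
    also have "\<dots> = ennreal (\<theta> * exp (\<theta> * u)) * indicator {p..q} u * emeasure M {u<..q}"
      by (rule nn_integral_cmult_indicator) simp
    finally show "(\<integral>\<^sup>+x. ?h (x, u) \<partial>M)
        = ennreal (\<theta> * exp (\<theta> * u)) * indicator {p..q} u * emeasure M {u<..q}" .
  qed
  also have "\<dots> \<le> (\<integral>\<^sup>+u. ennreal (\<theta> * A * exp ((\<theta> - \<kappa>) * u)) * indicator {p..q} u \<partial>lborel)"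
  proof (rule nn_integral_mono)
    fix u
    show "ennreal (\<theta> * exp (\<theta> * u)) * indicator {p..q} u * emeasure M {u<..q}
        \<le> ennreal (\<theta> * A * exp ((\<theta> - \<kappa>) * u)) * indicator {p..q} u"
    proof (cases "u \<in> {p..q}")
      case True
      have "emeasure M {u<..q} \<le> emeasure M {u<..}"
        by (rule emeasure_mono) auto
      also have "\<dots> \<le> ennreal (A * exp (- \<kappa> * u))"
        using tail_le[of u] True
        by (simp add: emeasure_eq_measure tail_eq_measure ennreal_leI)
      finally have "ennreal (\<theta> * exp (\<theta> * u)) * emeasure M {u<..q}
          \<le> ennreal (\<theta> * exp (\<theta> * u)) * ennreal (A * exp (- \<kappa> * u))"
        by (rule mult_left_mono) simp
      also have "\<dots> = ennreal (\<theta> * A * exp ((\<theta> - \<kappa>) * u))"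
        using \<open>0 < \<theta>\<close> A
        by (simp add: algebra_simps exp_diff exp_minus divide_inverse flip: ennreal_mult')
      finally show ?thesis using True by simp
    qed simp
  qed
  also have "\<dots> = ennreal (?F q - ?F p)"
    using assms A
    by (intro nn_integral_FTC_Icc) (auto intro!: derivative_eq_intros)
  also have "ennreal (exp (\<theta> * p)) * emeasure M {p<..q} \<le> ennreal (A * exp ((\<theta> - \<kappa>) * p))"
  proof -
    have "emeasure M {p<..q} \<le> emeasure M {p<..}"
      by (rule emeasure_mono) auto
    also have "\<dots> \<le> ennreal (A * exp (- \<kappa> * p))"
      using tail_le[of p] assms
      by (simp add: emeasure_eq_measure tail_eq_measure ennreal_leI)
    finally have "ennreal (exp (\<theta> * p)) * emeasure M {p<..q}
        \<le> ennreal (exp (\<theta> * p)) * ennreal (A * exp (- \<kappa> * p))"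
      by (rule mult_left_mono) simp
    then show ?thesis
      using A
      by (simp add: algebra_simps exp_diff exp_minus divide_inverse flip: ennreal_mult')
  qed
  finally have "(\<integral>\<^sup>+x. ennreal (indicator {p<..q} x * exp (\<theta> * x)) \<partial>M)
      \<le> ennreal (A * exp ((\<theta> - \<kappa>) * p)) + ennreal (?F q - ?F p)"
    by (simp add: add_mono)
  also have "\<dots> = ennreal (A * exp ((\<theta> - \<kappa>) * p) + (?F q - ?F p))"
    using A F_mono by (simp add: ennreal_plus)
  also have "A * exp ((\<theta> - \<kappa>) * p) + (?F q - ?F p) = ?R"
    by (rule R_eq)
  finally have nn: "(\<integral>\<^sup>+x. ennreal (indicator {p<..q} x * exp (\<theta> * x)) \<partial>M) \<le> ennreal ?R" .
  have R_nonneg: "0 \<le> ?R"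
    using A F_mono by (simp flip: R_eq)
  have "(LINT x:{p<..q}|M. exp (\<theta> * x))
      = enn2real (\<integral>\<^sup>+x. ennreal (indicator {p<..q} x * exp (\<theta> * x)) \<partial>M)"
    unfolding set_lebesgue_integral_def
    by (subst integral_eq_nn_integral) auto
  also have "\<dots> \<le> enn2real (ennreal ?R)"
    by (rule enn2real_mono[OF nn]) simp
  finally show ?thesis
    using R_nonneg by simp
qed

text \<open>A pointwise bound, integrated: on \<open>{- w..p}\<close> the quadratic estimate applies
  because \<open>\<theta> * x \<le> c\<close>, below \<open>- w\<close> the exponential is at most
  1, and above \<open>p\<close> it is kept as the last integral. The moments may be truncated at a
  level \<open>w\<close> beyond \<open>p\<close>, since points of \<open>{p<..w}\<close> add only
  nonnegative terms to the right-hand side.\<close>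

lemma truncated_mgf_le:
  fixes \<theta> p w y c :: real
  assumes "0 \<le> \<theta>" "0 \<le> p" "p \<le> w" "\<theta> * p \<le> c"
  shows "(LINT x:{..y}|M. exp (\<theta> * x))
    \<le> 1 + \<theta> * mu1 M w + exp c * \<theta>\<^sup>2 * mu2 M w + cdf M (- w) + (LINT x:{p<..y}|M. exp (\<theta> * x))"
proof -
  let ?W = "{x. \<bar>x\<bar> \<le> w}"
  have c: "0 \<le> c"
    using assms by (smt (verit) mult_nonneg_nonneg)
  have w: "0 \<le> w" using assms by simp
  have [measurable]: "?W \<in> sets borel"
    by measurable
  have i1: "integrable M (\<lambda>x. indicator ?W x * x)"
    by (rule integrable_const_bound[where B = w]) (use w in \<open>auto simp: indicator_def\<close>)
  have i2: "integrable M (\<lambda>x. indicator ?W x * x\<^sup>2)"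
    by (rule integrable_const_bound[where B = "w\<^sup>2"])
       (use w in \<open>auto simp: indicator_def abs_le_square_iff[symmetric]\<close>)
  have i3: "integrable M (indicat_real {..- w})"
    by (rule integrable_const_bound[where B = 1]) (auto simp: indicator_def)
  have i4: "integrable M (\<lambda>x. indicator {p<..y} x * exp (\<theta> * x))"
    using set_integrable_exp_bounded[of "{p<..y}" y \<theta>] assms by (simp add: set_integrable_def)
  have i5: "integrable M (\<lambda>x. indicator {..y} x * exp (\<theta> * x))"
    using set_integrable_exp_bounded[of "{..y}" y \<theta>] assms by (simp add: set_integrable_def)
  have "(\<integral>x. indicator {..y} x * exp (\<theta> * x) \<partial>M)
    \<le> (\<integral>x. 1 + \<theta> * (indicator ?W x * x) + exp c * \<theta>\<^sup>2 * (indicator ?W x * x\<^sup>2)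
        + indicator {..- w} x + indicator {p<..y} x * exp (\<theta> * x) \<partial>M)"
  proof (rule integral_mono[OF i5])
    show "integrable M (\<lambda>x. 1 + \<theta> * (indicator ?W x * x) + exp c * \<theta>\<^sup>2 * (indicator ?W x * x\<^sup>2)
        + indicator {..- w} x + indicator {p<..y} x * exp (\<theta> * x))"
      using i1 i2 i3 i4 by auto
    fix x
    have q: "0 \<le> exp c * \<theta>\<^sup>2 * (indicator ?W x * x\<^sup>2)" by (simp add: indicator_def)
    show "indicator {..y} x * exp (\<theta> * x) \<le> 1 + \<theta> * (indicator ?W x * x)
        + exp c * \<theta>\<^sup>2 * (indicator ?W x * x\<^sup>2) + indicator {..- w} x + indicator {p<..y} x * exp (\<theta> * x)"
    proof (cases "p < x")
      case True
      then have "0 \<le> \<theta> * (indicator ?W x * x)"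
        using assms by (simp add: indicator_def)
      then show ?thesis using q True by (auto simp: indicator_def)
    next
      case False
      show ?thesis
      proof (cases "x < - w")
        case True
        then have "exp (\<theta> * x) \<le> 1"
          using w \<open>0 \<le> \<theta>\<close> by (simp add: mult_nonneg_nonpos)
        then have "exp (\<theta> * x) \<le> 2" by linarith
        then show ?thesis using q True False by (auto simp: indicator_def)
      next
        case nw: False
        have \<theta>x: "\<theta> * x \<le> c"
          using False assms by (smt (verit) mult_left_mono)
        have up: "exp (\<theta> * x) \<le> 1 + \<theta> * x + exp c * \<theta>\<^sup>2 * x\<^sup>2"
          using exp_le_one_plus_quadratic[OF \<theta>x c] by (simp add: power_mult_distrib mult.assoc)
        moreover have "indicat_real ?W x = 1"
          using False nw assms by (auto simp: indicator_def)
        ultimately show ?thesis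
          using False order_trans[OF exp_ge_zero up] by (auto simp: indicator_def)
      qed
    qed
  qed
  also have "\<dots> = 1 + \<theta> * mu1 M w + exp c * \<theta>\<^sup>2 * mu2 M w + cdf M (- w) + (LINT x:{p<..y}|M. exp (\<theta> * x))"
    using i1 i2 i3 i4 prob_space
    by (simp add: mu1_def mu2_def cdf_def set_lebesgue_integral_def)
  finally show ?thesis
    by (simp add: set_lebesgue_integral_def)
qed

end

section \<open>Sums of independent, identically distributed variables\<close>

locale iid_variables = prob_space M + law: real_distribution D
  for M :: "'a measure" and D :: "real measure" +
  fixes X :: "'i \<Rightarrow> 'a \<Rightarrow> real" and I :: "'i set"
  assumes finite_I: "finite I"
    and indep: "indep_vars (\<lambda>_. borel) X I"
    and distr_eq: "\<And>i. i \<in> I \<Longrightarrow> distr M borel (X i) = D"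
begin

lemma random_variable_X [measurable]: "i \<in> I \<Longrightarrow> random_variable borel (X i)"
  using indep by (simp add: indep_vars_def)

lemma prob_X_in:
  assumes "i \<in> I" "A \<in> sets borel"
  shows "prob {\<omega> \<in> space M. X i \<omega> \<in> A} = measure D A"
proof -
  have "measure (distr M borel (X i)) A = prob (X i -` A \<inter> space M)"
    using assms by (intro measure_distr) auto
  then show ?thesis
    using assms by (simp add: distr_eq vimage_def Int_def conj_commute)
qed

lemma integral_comp_X:
  fixes f :: "real \<Rightarrow> real"
  assumes "i \<in> I" "f \<in> borel_measurable borel"
  shows "expectation (\<lambda>\<omega>. f (X i \<omega>)) = (\<integral>x. f x \<partial>D)"
proof -
  have "(\<integral>x. f x \<partial>distr M borel (X i)) = expectation (\<lambda>\<omega>. f (X i \<omega>))"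
    using assms by (intro integral_distr) auto
  then show ?thesis using assms by (simp add: distr_eq)
qed

lemma integrable_comp_X:
  fixes f :: "real \<Rightarrow> real"
  assumes "i \<in> I" "f \<in> borel_measurable borel" "integrable D f"
  shows "integrable M (\<lambda>\<omega>. f (X i \<omega>))"
  using assms integrable_distr_eq[of "X i" M borel f] by (simp add: distr_eq)

lemma prob_X_gt_pair:
  assumes "i \<in> I" "j \<in> I" "i \<noteq> j"
  shows "prob {\<omega> \<in> space M. u < X i \<omega> \<and> v < X j \<omega>} = tail D u * tail D v"
proof -
  \<comment> \<open>Independence of the pair is obtained as independence of \<open>X i\<close> from
    the sum over the singleton \<open>{j}\<close>.\<close>
  have "indep_vars (\<lambda>_. borel) X (insert i {j})"
    using indep by (rule indep_vars_subset) (use assms in auto)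
  from indep_vars_sum[OF _ _ this] have "indep_var borel (X i) borel (X j)"
    using assms by simp
  from indep_varD[OF this, of "{u<..}" "{v<..}"]
  have "prob ((\<lambda>x. (X i x, X j x)) -` ({u<..} \<times> {v<..}) \<inter> space M)
      = prob {\<omega> \<in> space M. X i \<omega> \<in> {u<..}} * prob {\<omega> \<in> space M. X j \<omega> \<in> {v<..}}"
    by (simp add: vimage_def Int_def conj_commute)
  also have "(\<lambda>x. (X i x, X j x)) -` ({u<..} \<times> {v<..}) \<inter> space M
      = {\<omega> \<in> space M. u < X i \<omega> \<and> v < X j \<omega>}"
    by auto
  finally show ?thesis
    using assms by (simp only: prob_X_in law.tail_eq_measure greaterThan_borel)
qed

text \<open>Exponential Markov inequality on a box: the indicator of the event is at most
  \<open>exp (- \<theta> * s)\<close> times the product of the truncated exponentials, whose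
  expectation factorises by independence. The common bound \<open>q\<close> makes these exponentials
  bounded. The sets \<open>A i\<close> vary with \<open>i\<close> so that one summand can be singled
  out in \<open>prob_sum_gt_upper\<close>.\<close>

lemma prob_sum_gt_le_exp:
  assumes "0 \<le> \<theta>" and A: "\<And>i. i \<in> I \<Longrightarrow> A i \<in> sets borel"
    and bdd: "\<And>i x. i \<in> I \<Longrightarrow> x \<in> A i \<Longrightarrow> x \<le> q"
  shows "prob {\<omega> \<in> space M. s < (\<Sum>i\<in>I. X i \<omega>) \<and> (\<forall>i\<in>I. X i \<omega> \<in> A i)}
    \<le> exp (- \<theta> * s) * (\<Prod>i\<in>I. LINT x:A i|D. exp (\<theta> * x))"
proof -
  let ?f = "\<lambda>i x. indicat_real (A i) x * exp (\<theta> * x)"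
  have f_meas: "?f i \<in> borel_measurable borel" if "i \<in> I" for i
    using A[OF that] by measurable
  have f_int: "integrable D (?f i)" if "i \<in> I" for i
    using law.set_integrable_exp_bounded[of "A i" q \<theta>] A[OF that] bdd[OF that] \<open>0 \<le> \<theta>\<close>
    by (simp add: set_integrable_def)
  have ind: "indep_vars (\<lambda>_. borel) (\<lambda>i \<omega>. ?f i (X i \<omega>)) I"
    by (rule indep_vars_compose2[OF indep]) (rule f_meas)
  have int: "integrable M (\<lambda>\<omega>. ?f i (X i \<omega>))" if "i \<in> I" for i
    using that by (intro integrable_comp_X f_meas f_int)
  have prod_int: "integrable M (\<lambda>\<omega>. \<Prod>i\<in>I. ?f i (X i \<omega>))"
    by (rule indep_vars_integrable[OF finite_I ind int])
  let ?E = "{\<omega> \<in> space M. s < (\<Sum>i\<in>I. X i \<omega>) \<and> (\<forall>i\<in>I. X i \<omega> \<in> A i)}"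
  have E: "?E \<in> events"
  proof -
    have "{\<omega> \<in> space M. s < (\<Sum>i\<in>I. X i \<omega>)} \<in> events"
      by measurable
    moreover have "{\<omega> \<in> space M. \<forall>i\<in>I. X i \<omega> \<in> A i} \<in> events"
      by (rule sets.sets_Collect_finite_All[OF _ finite_I])
         (use A measurable_sets[OF random_variable_X] in \<open>auto simp: vimage_def Int_def conj_commute\<close>)
    ultimately have "{\<omega> \<in> space M. s < (\<Sum>i\<in>I. X i \<omega>)} \<inter> {\<omega> \<in> space M. \<forall>i\<in>I. X i \<omega> \<in> A i} \<in> events"
      by (rule sets.Int)
    then show ?thesis
      by (simp add: Int_def conj_ac)
  qed
  have "prob ?E = expectation (indicator ?E)"
    using E by simp
  also have "\<dots> \<le> expectation (\<lambda>\<omega>. exp (- \<theta> * s) * (\<Prod>i\<in>I. ?f i (X i \<omega>)))"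
  proof (rule integral_mono)
    show "integrable M (\<lambda>\<omega>. exp (- \<theta> * s) * (\<Prod>i\<in>I. ?f i (X i \<omega>)))"
      using prod_int by simp
    show "integrable M (indicat_real ?E)"
      using E by (intro integrable_const_bound[where B = 1]) auto
    fix \<omega>
    show "indicator ?E \<omega> \<le> exp (- \<theta> * s) * (\<Prod>i\<in>I. ?f i (X i \<omega>))"
    proof (cases "\<omega> \<in> ?E")
      case True
      then have "(\<Prod>i\<in>I. ?f i (X i \<omega>)) = (\<Prod>i\<in>I. exp (\<theta> * X i \<omega>))"
        by (intro prod.cong) auto
      also have "\<dots> = exp (\<theta> * (\<Sum>i\<in>I. X i \<omega>))"
        using finite_I by (simp add: exp_sum sum_distrib_left)
      finally have "exp (- \<theta> * s) * (\<Prod>i\<in>I. ?f i (X i \<omega>)) = exp (\<theta> * ((\<Sum>i\<in>I. X i \<omega>) - s))"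
        by (simp add: algebra_simps flip: exp_add)
      moreover have "0 \<le> \<theta> * ((\<Sum>i\<in>I. X i \<omega>) - s)"
        using True \<open>0 \<le> \<theta>\<close> by (intro mult_nonneg_nonneg) auto
      ultimately show ?thesis
        using True by simp
    next
      case False
      then show ?thesis by (simp add: prod_nonneg)
    qed
  qed
  also have "\<dots> = exp (- \<theta> * s) * (\<Prod>i\<in>I. expectation (\<lambda>\<omega>. ?f i (X i \<omega>)))"
    using indep_vars_lebesgue_integral[OF finite_I ind int] by simp
  also have "(\<Prod>i\<in>I. expectation (\<lambda>\<omega>. ?f i (X i \<omega>))) = (\<Prod>i\<in>I. LINT x:A i|D. exp (\<theta> * x))"
    using f_meas by (intro prod.cong refl) (simp add: integral_comp_X[OF _ f_meas] set_lebesgue_integral_def)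
  finally show ?thesis .
qed

text \<open>Induction on \<open>J\<close>, the new summand being independent of the partial sum. The
  exact value is smaller by \<open>card J\<close> times the squared mean, which is given up.\<close>

lemma second_moment_sum_le:
  fixes f :: "real \<Rightarrow> real"
  assumes f: "f \<in> borel_measurable borel" and bdd: "\<And>x. \<bar>f x\<bar> \<le> C" and "J \<subseteq> I"
  shows "expectation (\<lambda>\<omega>. (\<Sum>i\<in>J. f (X i \<omega>))\<^sup>2)
    \<le> card J * (\<integral>x. (f x)\<^sup>2 \<partial>D) + (card J * (\<integral>x. f x \<partial>D))\<^sup>2"
proof -
  have "finite J" using \<open>J \<subseteq> I\<close> finite_I by (rule finite_subset)
  then show ?thesis using \<open>J \<subseteq> I\<close>
  proof (induction J rule: finite_induct)
    case empty
    then show ?case by simp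
  next
    case (insert i J)
    define m where "m = (\<integral>x. f x \<partial>D)"
    have i: "i \<in> I" and J: "J \<subseteq> I" using insert by auto
    let ?Y = "\<lambda>i \<omega>. f (X i \<omega>)"
    let ?S = "\<lambda>\<omega>. \<Sum>j\<in>J. ?Y j \<omega>"
    have [measurable]: "f \<in> borel_measurable borel" by (rule f)
    have Y_meas [measurable]: "random_variable borel (?Y j)" if "j \<in> I" for j
      using that by measurable
    have S_meas [measurable]: "random_variable borel ?S"
      using J by (intro borel_measurable_sum Y_meas) auto
    have S_bdd: "\<bar>?S \<omega>\<bar> \<le> card J * C" for \<omega>
      by (rule order_trans[OF sum_abs sum_bounded_above]) (rule bdd)
    have C: "0 \<le> C" using bdd[of 0] by simp
    have Y_int: "integrable M (?Y j)" if "j \<in> I" for j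
      using that bdd by (intro integrable_const_bound[where B = C]) auto
    have S_int: "integrable M ?S"
      using J by (intro Bochner_Integration.integrable_sum Y_int) auto
    have Y2_int: "integrable M (\<lambda>\<omega>. (?Y i \<omega>)\<^sup>2)"
      using i bdd C by (intro integrable_const_bound[where B = "C\<^sup>2"])
        (auto simp: abs_le_square_iff[symmetric])
    have S2_int: "integrable M (\<lambda>\<omega>. (?S \<omega>)\<^sup>2)"
      using S_bdd C by (intro integrable_const_bound[where B = "(card J * C)\<^sup>2"])
        (auto simp: abs_le_square_iff[symmetric])
    have "indep_vars (\<lambda>_. borel) (\<lambda>i \<omega>. f (X i \<omega>)) (insert i J)"
      by (rule indep_vars_compose2[OF indep_vars_subset[OF indep insert.prems]]) (rule f)
    then have ind: "indep_var borel (?Y i) borel ?S"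
      by (rule indep_vars_sum[OF \<open>finite J\<close> \<open>i \<notin> J\<close>])
    have YS: "expectation (\<lambda>\<omega>. ?Y i \<omega> * ?S \<omega>) = m * (card J * m)"
    proof -
      have "expectation (\<lambda>\<omega>. ?Y i \<omega> * ?S \<omega>) = expectation (?Y i) * expectation ?S"
        by (rule indep_var_lebesgue_integral[OF ind Y_int[OF i] S_int])
      also have "expectation ?S = (\<Sum>j\<in>J. expectation (?Y j))"
        using J by (intro Bochner_Integration.integral_sum Y_int) auto
      also have "\<dots> = card J * m"
        using J f by (simp add: integral_comp_X m_def subset_iff)
      finally show ?thesis
        using i f by (simp add: integral_comp_X m_def)
    qed
    have YS_int: "integrable M (\<lambda>\<omega>. ?Y i \<omega> * ?S \<omega>)"
      by (rule indep_var_integrable[OF ind Y_int[OF i] S_int])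
    have "expectation (\<lambda>\<omega>. (\<Sum>j\<in>insert i J. ?Y j \<omega>)\<^sup>2)
        = expectation (\<lambda>\<omega>. (?Y i \<omega>)\<^sup>2 + (?S \<omega>)\<^sup>2 + 2 * (?Y i \<omega> * ?S \<omega>))"
      using insert.hyps by (simp add: power2_sum mult.assoc)
    also have "\<dots> = expectation (\<lambda>\<omega>. (?Y i \<omega>)\<^sup>2) + expectation (\<lambda>\<omega>. (?S \<omega>)\<^sup>2)
        + 2 * (m * (card J * m))"
      using Y2_int S2_int YS_int YS by simp
    also have "expectation (\<lambda>\<omega>. (?Y i \<omega>)\<^sup>2) = (\<integral>x. (f x)\<^sup>2 \<partial>D)"
      using i f integral_comp_X[of i "\<lambda>x. (f x)\<^sup>2"] by simp
    also have "expectation (\<lambda>\<omega>. (?S \<omega>)\<^sup>2) \<le> card J * (\<integral>x. (f x)\<^sup>2 \<partial>D) + (card J * m)\<^sup>2"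
      using insert.IH J by (simp add: m_def)
    finally have "expectation (\<lambda>\<omega>. (\<Sum>j\<in>insert i J. ?Y j \<omega>)\<^sup>2)
        \<le> (\<integral>x. (f x)\<^sup>2 \<partial>D) + (card J * (\<integral>x. (f x)\<^sup>2 \<partial>D) + (card J * m)\<^sup>2) + 2 * (m * (card J * m))"
      by simp
    also have "\<dots> \<le> card (insert i J) * (\<integral>x. (f x)\<^sup>2 \<partial>D) + (card (insert i J) * m)\<^sup>2"
      using insert.hyps by (simp add: algebra_simps power2_eq_square)
    finally show ?case by (simp add: m_def)
  qed
qed

text \<open>Either some summand lies outside \<open>(-w, w]\<close>, which a union bound controls,
  or the sum agrees with its truncation and Chebyshev's inequality around 0 applies. Since nothing
  is centred, the mean enters through the square of \<open>card J * mu1 D w\<close>.\<close>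

lemma prob_sum_le_neg:
  assumes J: "J \<subseteq> I" and "0 < w" "0 < \<delta>"
  shows "prob {\<omega> \<in> space M. (\<Sum>i\<in>J. X i \<omega>) \<le> - \<delta>}
    \<le> card J * (cdf D (- w) + tail D w) + (card J * mu2 D w + (card J * mu1 D w)\<^sup>2) / \<delta>\<^sup>2"
proof -
  let ?W = "{x. \<bar>x\<bar> \<le> w}"
  let ?f = "\<lambda>x. indicat_real ?W x * x"
  have [measurable]: "?W \<in> sets borel" by measurable
  have f: "?f \<in> borel_measurable borel" by measurable
  have bdd: "\<bar>?f x\<bar> \<le> w" for x using \<open>0 < w\<close> by (auto simp: indicator_def)
  have fin: "finite J" using J finite_I by (rule finite_subset)
  have X_meas [measurable]: "random_variable borel (X i)" if "i \<in> J" for i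
    using that J by auto
  let ?S = "\<lambda>\<omega>. \<Sum>i\<in>J. ?f (X i \<omega>)"
  have S_meas [measurable]: "random_variable borel ?S"
    by (intro borel_measurable_sum measurable_compose[OF X_meas f])
  have S_bdd: "\<bar>?S \<omega>\<bar> \<le> card J * w" for \<omega>
    by (rule order_trans[OF sum_abs sum_bounded_above]) (rule bdd)
  have S2_int: "integrable M (\<lambda>\<omega>. (?S \<omega>)\<^sup>2)"
    using S_bdd \<open>0 < w\<close> by (intro integrable_const_bound[where B = "(card J * w)\<^sup>2"])
      (auto simp: abs_le_square_iff[symmetric])
  let ?L = "{\<omega> \<in> space M. \<delta> \<le> \<bar>?S \<omega>\<bar>}"
  have L: "?L \<in> events" by measurable
  let ?O = "\<lambda>i. {\<omega> \<in> space M. X i \<omega> \<in> {..- w} \<union> {w<..}}"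
  have O: "?O i \<in> events" if "i \<in> J" for i
    using measurable_sets[OF X_meas[OF that], of "{..- w} \<union> {w<..}"]
    by (simp add: vimage_def Int_def conj_commute)
  have "{\<omega> \<in> space M. (\<Sum>i\<in>J. X i \<omega>) \<le> - \<delta>} \<subseteq> (\<Union>i\<in>J. ?O i) \<union> ?L"
  proof
    fix \<omega> assume \<omega>: "\<omega> \<in> {\<omega> \<in> space M. (\<Sum>i\<in>J. X i \<omega>) \<le> - \<delta>}"
    show "\<omega> \<in> (\<Union>i\<in>J. ?O i) \<union> ?L"
    proof (cases "\<exists>i\<in>J. \<omega> \<in> ?O i")
      case False
      then have "?S \<omega> = (\<Sum>i\<in>J. X i \<omega>)"
        using \<omega> by (intro sum.cong) (auto simp: indicator_def abs_le_iff)
      then show ?thesis using \<omega> by auto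
    qed auto
  qed
  then have "prob {\<omega> \<in> space M. (\<Sum>i\<in>J. X i \<omega>) \<le> - \<delta>} \<le> prob ((\<Union>i\<in>J. ?O i) \<union> ?L)"
    using O fin by (intro finite_measure_mono sets.Un sets.finite_UN L) auto
  also have "\<dots> \<le> prob (\<Union>i\<in>J. ?O i) + prob ?L"
    using O fin by (intro measure_Un_le sets.finite_UN L) auto
  also have "prob (\<Union>i\<in>J. ?O i) \<le> (\<Sum>i\<in>J. prob (?O i))"
    using O fin by (intro finite_measure_subadditive_finite) auto
  also have "(\<Sum>i\<in>J. prob (?O i)) = (\<Sum>i\<in>J. cdf D (- w) + tail D w)"
  proof (rule sum.cong)
    fix i assume "i \<in> J"
    have "prob (?O i) = measure D ({..- w} \<union> {w<..})"
      using \<open>i \<in> J\<close> J by (intro prob_X_in) auto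
    also have "\<dots> = measure D {..- w} + measure D {w<..}"
      using \<open>0 < w\<close> by (intro law.finite_measure_Union) auto
    finally show "prob (?O i) = cdf D (- w) + tail D w"
      by (simp add: cdf_def law.tail_eq_measure)
  qed simp
  also have "prob ?L \<le> expectation (\<lambda>\<omega>. (?S \<omega>)\<^sup>2) / \<delta>\<^sup>2"
    using second_moment_method[OF S_meas S2_int \<open>0 < \<delta>\<close>] by simp
  also have "expectation (\<lambda>\<omega>. (?S \<omega>)\<^sup>2) \<le> card J * (\<integral>x. (?f x)\<^sup>2 \<partial>D) + (card J * (\<integral>x. ?f x \<partial>D))\<^sup>2"
    by (rule second_moment_sum_le[OF f bdd J])
  also have "(\<integral>x. (?f x)\<^sup>2 \<partial>D) = mu2 D w"
    unfolding mu2_def set_lebesgue_integral_def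
    by (intro Bochner_Integration.integral_cong) (auto simp: indicator_def)
  also have "(\<integral>x. ?f x \<partial>D) = mu1 D w"
    by (simp add: mu1_def set_lebesgue_integral_def)
  finally show ?thesis
    by (simp add: divide_right_mono)
qed

section \<open>Upper and lower decompositions of the event that the sum is large\<close>

lemma sum_gt_event: "J \<subseteq> I \<Longrightarrow> {\<omega> \<in> space M. u < (\<Sum>i\<in>J. X i \<omega>)} \<in> events"
proof -
  assume "J \<subseteq> I"
  then have "random_variable borel (\<lambda>\<omega>. \<Sum>i\<in>J. X i \<omega>)"
    by (intro borel_measurable_sum random_variable_X) auto
  then show ?thesis by measurable
qed

lemma prob_X_gt: "i \<in> I \<Longrightarrow> prob {\<omega> \<in> space M. u < X i \<omega>} = tail D u"
  using prob_X_in[of i "{u<..}"] by (simp add: law.tail_eq_measure)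

text \<open>The event is covered by four cases, one for each term: some summand exceeds
  \<open>z\<close>; two summands exceed \<open>y\<close>; all are at most \<open>y\<close>; exactly
  one lies in \<open>{y<..z}\<close> and the others are at most \<open>y\<close>. The first two are
  union bounds, with ordered pairs counted crudely by the square of \<open>n\<close>; the other two
  use \<open>prob_sum_gt_le_exp\<close>.\<close>

lemma prob_sum_gt_upper:
  assumes "0 \<le> \<theta>" "y \<le> z"
  defines "n \<equiv> card I" and "m \<equiv> LINT x:{..y}|D. exp (\<theta> * x)"
  shows "prob {\<omega> \<in> space M. s < (\<Sum>i\<in>I. X i \<omega>)}
    \<le> n * tail D z + (n * tail D y)\<^sup>2 + exp (- \<theta> * s) * m ^ n
      + n * (exp (- \<theta> * s) * ((LINT x:{y<..z}|D. exp (\<theta> * x)) * m ^ (n - 1)))"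
proof -
  let ?S = "\<lambda>\<omega>. \<Sum>i\<in>I. X i \<omega>"
  let ?A = "\<lambda>i. {\<omega> \<in> space M. z < X i \<omega>}"
  let ?K = "{(i, j). i \<in> I \<and> j \<in> I \<and> i \<noteq> j}"
  let ?B = "\<lambda>(i, j). {\<omega> \<in> space M. y < X i \<omega> \<and> y < X j \<omega>}"
  let ?C = "{\<omega> \<in> space M. s < ?S \<omega> \<and> (\<forall>j\<in>I. X j \<omega> \<in> {..y})}"
  let ?E = "\<lambda>i. {\<omega> \<in> space M. s < ?S \<omega> \<and> (\<forall>j\<in>I. X j \<omega> \<in> (if j = i then {y<..z} else {..y}))}"
  have K: "?K \<subseteq> I \<times> I" by auto
  then have finK: "finite ?K" by (rule finite_subset) (simp add: finite_I)
  have cardK: "card ?K \<le> n * n"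
    using card_mono[OF _ K] finite_I by (simp add: n_def card_cartesian_product)
  have box: "{\<omega> \<in> space M. s < ?S \<omega> \<and> (\<forall>j\<in>I. X j \<omega> \<in> F j)} \<in> events"
    if "\<And>j. F j \<in> sets borel" for F
  proof -
    have "{\<omega> \<in> space M. \<forall>j\<in>I. X j \<omega> \<in> F j} \<in> events"
      by (rule sets.sets_Collect_finite_All[OF _ finite_I])
         (use that measurable_sets[OF random_variable_X] in \<open>auto simp: vimage_def Int_def conj_commute\<close>)
    from sets.Int[OF sum_gt_event[OF order_refl, of s] this] show ?thesis
      by (simp add: Int_def conj_ac)
  qed
  have A: "?A i \<in> events" if "i \<in> I" for i using that by measurable
  have B: "?B k \<in> events" if "k \<in> ?K" for k
  proof -
    have "?B k = {\<omega> \<in> space M. y < X (fst k) \<omega>} \<inter> {\<omega> \<in> space M. y < X (snd k) \<omega>}"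
      by (auto split: prod.splits)
    then show ?thesis using that by auto
  qed
  have C: "?C \<in> events" by (rule box) simp
  have E: "?E i \<in> events" for i by (rule box) simp
  have "{\<omega> \<in> space M. s < ?S \<omega>} \<subseteq> (\<Union>i\<in>I. ?A i) \<union> (\<Union>k\<in>?K. ?B k) \<union> ?C \<union> (\<Union>i\<in>I. ?E i)"
  proof
    fix \<omega> assume \<omega>: "\<omega> \<in> {\<omega> \<in> space M. s < ?S \<omega>}"
    show "\<omega> \<in> (\<Union>i\<in>I. ?A i) \<union> (\<Union>k\<in>?K. ?B k) \<union> ?C \<union> (\<Union>i\<in>I. ?E i)"
    proof (cases "\<exists>i\<in>I. y < X i \<omega>")
      case False
      then have "\<omega> \<in> ?C" using \<omega> by (auto simp: not_less)
      then show ?thesis by blast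
    next
      case True
      then obtain i where i: "i \<in> I" "y < X i \<omega>" by blast
      show ?thesis
      proof (cases "z < X i \<omega> \<or> (\<exists>j\<in>I. j \<noteq> i \<and> y < X j \<omega>)")
        case True
        then show ?thesis using i \<omega> by fastforce
      next
        case False
        then have "\<omega> \<in> ?E i" using i \<omega> by (auto simp: not_less)
        then show ?thesis using i by blast
      qed
    qed
  qed
  moreover have UA: "(\<Union>i\<in>I. ?A i) \<in> events" by (rule sets.finite_UN[OF finite_I A])
  moreover have UB: "(\<Union>k\<in>?K. ?B k) \<in> events" by (rule sets.finite_UN[OF finK B])
  moreover have UE: "(\<Union>i\<in>I. ?E i) \<in> events" by (rule sets.finite_UN[OF finite_I E])
  ultimately have "prob {\<omega> \<in> space M. s < ?S \<omega>}
      \<le> prob ((\<Union>i\<in>I. ?A i) \<union> (\<Union>k\<in>?K. ?B k) \<union> ?C \<union> (\<Union>i\<in>I. ?E i))"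
    using C by (intro finite_measure_mono sets.Un)
  also have "\<dots> \<le> prob (\<Union>i\<in>I. ?A i) + prob (\<Union>k\<in>?K. ?B k) + prob ?C + prob (\<Union>i\<in>I. ?E i)"
    using measure_Un_le[OF sets.Un[OF sets.Un[OF UA UB] C] UE]
      measure_Un_le[OF sets.Un[OF UA UB] C] measure_Un_le[OF UA UB] by linarith
  also have "prob (\<Union>i\<in>I. ?A i) \<le> n * tail D z"
  proof -
    have "prob (\<Union>i\<in>I. ?A i) \<le> (\<Sum>i\<in>I. prob (?A i))"
      by (rule finite_measure_subadditive_finite[OF finite_I]) (use A in blast)
    then show ?thesis by (simp add: prob_X_gt n_def)
  qed
  also have "prob (\<Union>k\<in>?K. ?B k) \<le> (n * tail D y)\<^sup>2"
  proof -
    have "prob (\<Union>k\<in>?K. ?B k) \<le> (\<Sum>k\<in>?K. prob (?B k))"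
      by (rule finite_measure_subadditive_finite[OF finK]) (use B in blast)
    also have "\<dots> = (\<Sum>k\<in>?K. tail D y * tail D y)"
      by (rule sum.cong) (auto simp: prob_X_gt_pair)
    also have "\<dots> = real (card ?K) * (tail D y * tail D y)"
      by simp
    also have "\<dots> \<le> real (n * n) * (tail D y * tail D y)"
      using cardK by (intro mult_right_mono of_nat_mono mult_nonneg_nonneg law.tail_nonneg)
    finally show ?thesis by (simp add: power2_eq_square mult_ac)
  qed
  also have "prob ?C \<le> exp (- \<theta> * s) * m ^ n"
    using prob_sum_gt_le_exp[of \<theta> "\<lambda>_. {..y}" y s] \<open>0 \<le> \<theta>\<close> by (simp add: m_def n_def)
  also have "prob (\<Union>i\<in>I. ?E i)
      \<le> n * (exp (- \<theta> * s) * ((LINT x:{y<..z}|D. exp (\<theta> * x)) * m ^ (n - 1)))"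
  proof -
    have "prob (?E i) \<le> exp (- \<theta> * s) * ((LINT x:{y<..z}|D. exp (\<theta> * x)) * m ^ (n - 1))"
      if "i \<in> I" for i
    proof -
      let ?F = "\<lambda>j. if j = i then {y<..z} else {..y}"
      have "prob (?E i) \<le> exp (- \<theta> * s) * (\<Prod>j\<in>I. LINT x:?F j|D. exp (\<theta> * x))"
        by (rule prob_sum_gt_le_exp[where q = z]) (use assms in \<open>auto split: if_splits\<close>)
      also have "(\<Prod>j\<in>I. LINT x:?F j|D. exp (\<theta> * x))
          = (LINT x:{y<..z}|D. exp (\<theta> * x)) * (\<Prod>j\<in>I - {i}. m)"
        using that finite_I by (subst prod.remove[of I i]) (auto simp: m_def intro!: prod.cong)
      also have "(\<Prod>j\<in>I - {i}. m) = m ^ (n - 1)"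
        using that by (simp add: n_def)
      finally show ?thesis .
    qed
    then have "(\<Sum>i\<in>I. prob (?E i))
        \<le> (\<Sum>i\<in>I. exp (- \<theta> * s) * ((LINT x:{y<..z}|D. exp (\<theta> * x)) * m ^ (n - 1)))"
      by (rule sum_mono)
    moreover have "prob (\<Union>i\<in>I. ?E i) \<le> (\<Sum>i\<in>I. prob (?E i))"
      by (rule finite_measure_subadditive_finite[OF finite_I]) (use E in blast)
    ultimately show ?thesis by (simp add: n_def)
  qed
  finally show ?thesis by simp
qed

text \<open>A Bonferroni-type bound: one summand exceeds \<open>s + \<delta>\<close> while the
  remaining ones, independent of it, sum to more than \<open>- \<delta>\<close>. Double exceedances
  cost at most the square of \<open>n * tail D (s + \<delta>)\<close>.\<close>

lemma prob_sum_gt_lower: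
  assumes "\<And>i. i \<in> I \<Longrightarrow> prob {\<omega> \<in> space M. (\<Sum>j\<in>I - {i}. X j \<omega>) \<le> - \<delta>} \<le> \<pi>"
  defines "n \<equiv> card I"
  shows "n * tail D (s + \<delta>) * (1 - \<pi> - n * tail D (s + \<delta>)) \<le> prob {\<omega> \<in> space M. s < (\<Sum>i\<in>I. X i \<omega>)}"
proof -
  let ?v = "s + \<delta>"
  let ?T = "\<lambda>i \<omega>. \<Sum>j\<in>I - {i}. X j \<omega>"
  let ?A = "\<lambda>i. {\<omega> \<in> space M. ?v < X i \<omega> \<and> - \<delta> < ?T i \<omega>}"
  let ?B = "\<lambda>i j. {\<omega> \<in> space M. ?v < X i \<omega> \<and> ?v < X j \<omega>}"
  \<comment> \<open>Removing the double exceedances makes the events disjoint: a common point of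
    \<open>?F i\<close> and \<open>?F j\<close> with \<open>i \<noteq> j\<close> would lie in
    \<open>?B i j\<close>.\<close>
  let ?F = "\<lambda>i. ?A i - (\<Union>j\<in>I - {i}. ?B i j)"
  have T: "random_variable borel (?T i)" for i
    by (intro borel_measurable_sum random_variable_X) auto
  have A: "?A i \<in> events" if "i \<in> I" for i
    using that T[of i] by measurable
  have B: "?B i j \<in> events" if "i \<in> I" "j \<in> I" for i j
    using that by measurable
  have UB: "(\<Union>j\<in>I - {i}. ?B i j) \<in> events" if "i \<in> I" for i
    using B that finite_I by (intro sets.finite_UN) auto
  have F: "?F i \<in> events" if "i \<in> I" for i
    using A[OF that] UB[OF that] by (rule sets.Diff)
  have F_ge: "tail D ?v * (1 - \<pi>) - n * (tail D ?v)\<^sup>2 \<le> prob (?F i)" if i: "i \<in> I" for i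
  proof -
    have "indep_vars (\<lambda>_. borel) X (insert i (I - {i}))"
      using indep i by (simp add: insert_absorb)
    from indep_vars_sum[OF _ _ this] have "indep_var borel (X i) borel (?T i)"
      using finite_I by simp
    from indep_varD[OF this, of "{?v<..}" "{- \<delta><..}"]
    have "prob ((\<lambda>\<omega>. (X i \<omega>, ?T i \<omega>)) -` ({?v<..} \<times> {- \<delta><..}) \<inter> space M)
        = prob {\<omega> \<in> space M. ?v < X i \<omega>} * prob {\<omega> \<in> space M. - \<delta> < ?T i \<omega>}"
      by (simp add: vimage_def Int_def conj_commute)
    moreover have "(\<lambda>\<omega>. (X i \<omega>, ?T i \<omega>)) -` ({?v<..} \<times> {- \<delta><..}) \<inter> space M = ?A i"
      by auto
    ultimately have pA: "prob (?A i) = tail D ?v * prob {\<omega> \<in> space M. - \<delta> < ?T i \<omega>}"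
      using i by (simp add: prob_X_gt)
    have "{\<omega> \<in> space M. ?T i \<omega> \<le> - \<delta>} \<in> events"
      using T[of i] by measurable
    from prob_compl[OF this]
    have "prob (space M - {\<omega> \<in> space M. ?T i \<omega> \<le> - \<delta>}) = 1 - prob {\<omega> \<in> space M. ?T i \<omega> \<le> - \<delta>}" .
    moreover have "space M - {\<omega> \<in> space M. ?T i \<omega> \<le> - \<delta>} = {\<omega> \<in> space M. - \<delta> < ?T i \<omega>}"
      by auto
    ultimately have "1 - \<pi> \<le> prob {\<omega> \<in> space M. - \<delta> < ?T i \<omega>}"
      using assms(1)[OF i] by simp
    then have A_ge: "tail D ?v * (1 - \<pi>) \<le> prob (?A i)"
      unfolding pA by (rule mult_left_mono) (rule law.tail_nonneg)
    have "prob (\<Union>j\<in>I - {i}. ?B i j) \<le> (\<Sum>j\<in>I - {i}. prob (?B i j))"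
      using B i finite_I by (intro finite_measure_subadditive_finite) auto
    also have "\<dots> = (\<Sum>j\<in>I - {i}. (tail D ?v)\<^sup>2)"
      using i by (intro sum.cong) (auto simp: prob_X_gt_pair power2_eq_square)
    also have "\<dots> \<le> n * (tail D ?v)\<^sup>2"
      by (simp add: n_def) (intro mult_right_mono of_nat_mono card_mono finite_I; auto)
    finally have B_le: "prob (\<Union>j\<in>I - {i}. ?B i j) \<le> n * (tail D ?v)\<^sup>2" .
    have "prob (?A i) \<le> prob (?F i \<union> (\<Union>j\<in>I - {i}. ?B i j))"
      by (rule finite_measure_mono[OF _ sets.Un[OF F[OF i] UB[OF i]]]) auto
    also have "\<dots> \<le> prob (?F i) + prob (\<Union>j\<in>I - {i}. ?B i j)"
      using F[OF i] UB[OF i] by (rule measure_Un_le)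
    finally show ?thesis using A_ge B_le by linarith
  qed
  have disj: "disjoint_family_on ?F I"
    unfolding disjoint_family_on_def by fastforce
  have sub: "(\<Union>i\<in>I. ?F i) \<subseteq> {\<omega> \<in> space M. s < (\<Sum>i\<in>I. X i \<omega>)}"
  proof
    fix \<omega> assume "\<omega> \<in> (\<Union>i\<in>I. ?F i)"
    then obtain i where i: "i \<in> I" and "\<omega> \<in> ?A i" by blast
    then show "\<omega> \<in> {\<omega> \<in> space M. s < (\<Sum>i\<in>I. X i \<omega>)}"
      using sum.remove[OF finite_I i, of "\<lambda>i. X i \<omega>"] by simp
  qed
  have "n * tail D ?v * (1 - \<pi> - n * tail D ?v) = (\<Sum>i\<in>I. tail D ?v * (1 - \<pi>) - n * (tail D ?v)\<^sup>2)"
    by (simp add: n_def algebra_simps power2_eq_square)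
  also have "\<dots> \<le> (\<Sum>i\<in>I. prob (?F i))"
    by (rule sum_mono) (rule F_ge)
  also have "\<dots> = prob (\<Union>i\<in>I. ?F i)"
    using F disj finite_I by (intro finite_measure_finite_Union[symmetric]) auto
  also have "\<dots> \<le> prob {\<omega> \<in> space M. s < (\<Sum>i\<in>I. X i \<omega>)}"
    using sub sum_gt_event[of I] by (intro finite_measure_mono) auto
  finally show ?thesis .
qed

end


section \<open>Consequences of the hazard representation\<close>

lemma SUP_tendsto_zeroD:
  fixes f :: "nat \<Rightarrow> 'b \<Rightarrow> ereal"
  assumes "(\<lambda>n. SUP s\<in>S n. f n s) \<longlonglongrightarrow> 0" "0 < \<epsilon>"
  shows "\<forall>\<^sub>F n in sequentially. \<forall>s\<in>S n. f n s < ereal \<epsilon>"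
proof -
  have "\<forall>\<^sub>F n in sequentially. (SUP s\<in>S n. f n s) < ereal \<epsilon>"
    using assms by (intro order_tendstoD(2)[OF assms(1)]) simp
  then show ?thesis
    by eventually_elim (auto intro: le_less_trans[OF SUP_upper])
qed

text \<open>Nonemptiness of \<open>S n\<close> keeps the supremum from being minus infinity. Testing
  only \<open>\<epsilon> \<le> 1\<close> suffices and lets the main proof treat factors such as
  \<open>1 - \<epsilon> / 2\<close> as positive.\<close>

lemma SUP_tendsto_zeroI:
  fixes f :: "nat \<Rightarrow> 'b \<Rightarrow> real"
  assumes "\<And>n. S n \<noteq> {}" "\<And>n s. 0 \<le> f n s"
    and ev: "\<And>\<epsilon>. 0 < \<epsilon> \<Longrightarrow> \<epsilon> \<le> 1 \<Longrightarrow> \<forall>\<^sub>F n in sequentially. \<forall>s\<in>S n. f n s \<le> \<epsilon>"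
  shows "(\<lambda>n. SUP s\<in>S n. ereal (f n s)) \<longlonglongrightarrow> 0"
proof (rule order_tendstoI)
  fix y :: ereal assume "y < 0"
  have "0 \<le> (SUP s\<in>S n. ereal (f n s))" for n
    using assms(1)[of n] assms(2) by (force intro: SUP_upper2)
  then show "\<forall>\<^sub>F n in sequentially. y < (SUP s\<in>S n. ereal (f n s))"
    by (intro always_eventually allI less_le_trans[OF \<open>y < 0\<close>])
next
  fix y :: ereal assume "0 < y"
  then obtain e where e: "0 < ereal e" "ereal e < y"
    using ereal_dense2 by blast
  have "\<forall>\<^sub>F n in sequentially. \<forall>s\<in>S n. f n s \<le> min e 1"
    using e by (intro ev) auto
  then show "\<forall>\<^sub>F n in sequentially. (SUP s\<in>S n. ereal (f n s)) < y"
  proof eventually_elim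
    case (elim n)
    then have "(SUP s\<in>S n. ereal (f n s)) \<le> ereal e"
      by (intro SUP_least) auto
    then show ?case using e by simp
  qed
qed

text \<open>Beyond \<open>exp 1\<close> the logarithm is at least 1, and below it the factor
  \<open>exp 1\<close> is enough. This turns the growth condition, stated with
  \<open>k * ln k\<close>, into the bound \<open>K = o(a)\<close>.\<close>

lemma max_one_le_entropy:
  fixes k :: real
  shows "max 1 k \<le> exp 1 * max 1 (k * ln k)"
proof (cases "k \<le> exp 1")
  case True
  have "max 1 k \<le> exp 1 * 1" using True one_le_exp_iff[of "1::real"] by simp
  also have "\<dots> \<le> exp 1 * max 1 (k * ln k)" by (intro mult_left_mono) auto
  finally show ?thesis .
next
  case False
  then have k: "exp 1 < k" "1 < k" using exp_ge_add_one_self[of "1::real"] by linarith+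
  then have "1 \<le> ln k" by (simp add: ln_ge_iff)
  then have "k \<le> k * ln k" using k by simp
  then have "max 1 k \<le> 1 * max 1 (k * ln k)" by simp
  also have "\<dots> \<le> exp 1 * max 1 (k * ln k)" by (intro mult_right_mono) auto
  finally show ?thesis .
qed

section \<open>The concave part of the hazard function\<close>

locale hazard_representation = real_distribution D for D +
  fixes b \<eta> :: "real \<Rightarrow> real"
  assumes tail_pos: "\<And>x. 0 < tail D x"
    and representation: "psi_representation D b \<eta>"
begin

text \<open>The integral part of \<open>psi D\<close>. It is nondecreasing and concave on the closed
  half-line, so by \<open>psi_eq\<close> the function \<open>psi D\<close> stays within bounded
  distance of a concave one there.\<close>

definition cumulative :: "real \<Rightarrow> real" where
  "cumulative x = (LBINT u:{0..x}. \<eta> u)"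

lemma tail_eq_exp: "tail D x = exp (- psi D x)"
  using tail_pos by (simp add: psi_def)

lemma psi_eq: "0 \<le> x \<Longrightarrow> psi D x = b x + cumulative x"
  using representation by (simp add: psi_representation_def cumulative_def)

lemma eta_nonneg: "0 < u \<Longrightarrow> 0 \<le> \<eta> u"
  using representation by (simp add: psi_representation_def)

lemma eta_antimono: "0 < u \<Longrightarrow> u \<le> v \<Longrightarrow> \<eta> v \<le> \<eta> u"
  using representation by (auto simp: psi_representation_def monotone_on_def)

lemma eta_set_integrable: "set_integrable lborel {0..x} \<eta>"
  using representation by (cases "0 \<le> x") (auto simp: psi_representation_def)

lemma eta_Ioc_integrable: "0 \<le> x \<Longrightarrow> set_integrable lborel {x<..y} \<eta>"
  by (rule set_integrable_subset[OF eta_set_integrable[of y]]) auto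

lemma cumulative_diff:
  assumes "0 \<le> x" "x \<le> y"
  shows "cumulative y - cumulative x = (LBINT u:{x<..y}. \<eta> u)"
proof -
  have "{0..y} = {0..x} \<union> {x<..y}" using assms by auto
  then have "cumulative y = (LBINT u:{0..x} \<union> {x<..y}. \<eta> u)"
    by (simp add: cumulative_def)
  also have "\<dots> = (LBINT u:{0..x}. \<eta> u) + (LBINT u:{x<..y}. \<eta> u)"
    by (rule set_integral_Un)
       (use assms in \<open>auto intro: set_integrable_subset[OF eta_set_integrable[of y]] eta_set_integrable\<close>)
  finally show ?thesis by (simp add: cumulative_def)
qed

text \<open>On \<open>{x<..y}\<close> the integrand is at most its value at the left endpoint. That
  endpoint has to be positive because \<open>\<eta>\<close> is unconstrained at 0;
  \<open>cumulative_diff_ge\<close> uses the right endpoint and so permits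
  \<open>x = 0\<close>.\<close>

lemma cumulative_diff_le:
  assumes "0 < x" "x \<le> y"
  shows "cumulative y - cumulative x \<le> (y - x) * \<eta> x"
proof -
  have "(LBINT u:{x<..y}. \<eta> u) \<le> (LBINT u:{x<..y}. \<eta> x)"
    by (rule set_integral_mono)
       (use assms eta_Ioc_integrable in \<open>auto intro: eta_antimono simp: set_integrable_def\<close>)
  then show ?thesis
    using assms by (simp add: cumulative_diff set_lebesgue_integral_def)
qed

lemma cumulative_diff_ge:
  assumes "0 \<le> x" "x \<le> y"
  shows "(y - x) * \<eta> y \<le> cumulative y - cumulative x"
proof -
  have "(LBINT u:{x<..y}. \<eta> y) \<le> (LBINT u:{x<..y}. \<eta> u)"
    by (rule set_integral_mono)
       (use assms eta_Ioc_integrable in \<open>auto intro: eta_antimono simp: set_integrable_def\<close>)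
  then show ?thesis
    using assms by (simp add: cumulative_diff set_lebesgue_integral_def)
qed

text \<open>The value \<open>\<eta> y\<close> separates the mean slopes on the two sides of
  \<open>y\<close>. The inequality is kept free of denominators, so \<open>x = y\<close> and
  \<open>y = z\<close> are included.\<close>

lemma cumulative_concave:
  assumes "0 \<le> x" "x \<le> y" "0 < y" "y \<le> z"
  shows "(z - y) * cumulative x + (y - x) * cumulative z \<le> (z - x) * cumulative y"
proof -
  have "(y - x) * (cumulative z - cumulative y) \<le> (y - x) * ((z - y) * \<eta> y)"
    using assms by (intro mult_left_mono cumulative_diff_le) auto
  also have "\<dots> = (z - y) * ((y - x) * \<eta> y)"
    by simp
  also have "\<dots> \<le> (z - y) * (cumulative y - cumulative x)"
    using assms by (intro mult_left_mono cumulative_diff_ge) auto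
  finally show ?thesis by (simp add: algebra_simps)
qed

lemma b_bounded: "\<exists>B>0. \<forall>x\<ge>0. \<bar>b x\<bar> \<le> B"
proof -
  have "bounded (b ` {0..})"
    using representation by (simp add: psi_representation_def)
  then obtain B where "0 < B" "\<And>x. 0 \<le> x \<Longrightarrow> \<bar>b x\<bar> \<le> B"
    by (auto simp: bounded_pos)
  then show ?thesis by blast
qed

text \<open>If \<open>\<eta> u\<close> were 0, \<open>cumulative\<close> would stop growing at
  \<open>u\<close>, so \<open>psi D\<close> would be bounded above on \<open>{u..}\<close>; but the
  tail tends to 0.\<close>

lemma eta_pos:
  assumes "0 < u"
  shows "0 < \<eta> u"
proof (rule ccontr)
  assume "\<not> 0 < \<eta> u"
  then have 0: "\<eta> u = 0" using eta_nonneg[OF assms] by simp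
  obtain B where B: "\<And>x. 0 \<le> x \<Longrightarrow> \<bar>b x\<bar> \<le> B"
    using b_bounded by blast
  have "exp (- (B + cumulative u)) \<le> tail D v" if "u \<le> v" for v
  proof -
    have "psi D v \<le> B + cumulative u"
      using cumulative_diff_le[OF assms that] 0 B[of v] that assms by (simp add: psi_eq)
    then show ?thesis by (simp add: tail_eq_exp)
  qed
  moreover have "(tail D \<longlongrightarrow> 1 - 1) at_top"
    unfolding tail_def by (intro tendsto_intros cdf_lim_at_top_prob)
  then have "eventually (\<lambda>v. tail D v < exp (- (B + cumulative u))) at_top"
    by (rule order_tendstoD) simp
  then have "eventually (\<lambda>v. tail D v < exp (- (B + cumulative u)) \<and> u \<le> v) at_top"
    using eventually_ge_at_top by (rule eventually_conj)
  then obtain v where "tail D v < exp (- (B + cumulative u))" "u \<le> v"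
    by (metis (mono_tags, lifting) eventually_at_top_linorder order_refl)
  ultimately show False by force
qed

section \<open>Tail bounds from the hazard representation\<close>

lemma psi_diff_le:
  assumes "0 < x" "x \<le> y"
  shows "psi D y - psi D x \<le> (b y - b x) + (y - x) * \<eta> x"
  using cumulative_diff_le[OF assms] assms by (simp add: psi_eq)

text \<open>Linear interpolation of \<open>cumulative\<close>. It is at least
  \<open>ln n - B\<close> at \<open>s / a\<close> because \<open>n * tail D (s / a) \<le> 1\<close>,
  and at least \<open>ln n + q * l * a - B\<close> at \<open>l * s\<close> because
  \<open>psi D s = a + ln n\<close> and the increment from \<open>l * s\<close> to \<open>s\<close>
  is at most \<open>K\<close>. Concavity puts it above the chord in between. A further
  \<open>B\<close> is lost in returning to \<open>psi D u\<close>.\<close>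

lemma n_tail_le_exp:
  fixes n :: nat and B K a s l q :: real
  assumes B: "\<And>x. 0 \<le> x \<Longrightarrow> \<bar>b x\<bar> \<le> B"
    and n: "0 < n" and a: "a = a_fun D n s" and "0 < s" "0 < l" "l < 1" "0 \<le> q"
    and la: "1 \<le> l * a"
    and K: "s * \<eta> (l * s) \<le> K" "q * l * a \<le> a - K"
    and first: "n * tail D (s / a) \<le> 1"
    and u: "s / a \<le> u" "u \<le> l * s"
  shows "n * tail D u \<le> exp (2 * B + q) * exp (- (q * a / s) * u)"
proof -
  have a0: "0 < a"
    using la \<open>0 < l\<close> by (smt (verit) mult_nonneg_nonpos)
  define p where "p = s / a"
  have p: "0 < p" "p \<le> u" "u \<le> l * s"
    using a0 \<open>0 < s\<close> u by (auto simp: p_def)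
  have "ln (n * tail D p) \<le> ln 1"
    using first n tail_pos[of p] by (subst ln_le_cancel_iff) (auto simp: p_def)
  then have "ln (real n) \<le> psi D p"
    using n tail_pos[of p] by (simp add: psi_def ln_mult)
  then have gp: "ln n - B \<le> cumulative p"
    using B[of p] p by (simp add: psi_eq)
  have "psi D s = a + ln n"
    by (simp add: a a_fun_def)
  then have gs: "ln n + a - B \<le> cumulative s"
    using B[of s] \<open>0 < s\<close> by (simp add: psi_eq)
  have "l * s \<le> s"
    using \<open>l < 1\<close> \<open>0 < s\<close> by simp
  then have "cumulative s - cumulative (l * s) \<le> (s - l * s) * \<eta> (l * s)"
    using \<open>0 < s\<close> \<open>0 < l\<close> by (intro cumulative_diff_le) auto
  also have "\<dots> \<le> s * \<eta> (l * s)"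
    using \<open>0 < s\<close> \<open>0 < l\<close> eta_nonneg[of "l * s"] by (intro mult_right_mono) auto
  finally have gl: "ln n + q * l * a - B \<le> cumulative (l * s)"
    using K gs by linarith
  have "ln n - B + q * a * u / s - q \<le> cumulative u"
  proof (cases "p = l * s")
    case True
    then have "u = l * s" using p by simp
    then show ?thesis
      using gl \<open>0 \<le> q\<close> \<open>0 < s\<close> by (simp add: mult_ac)
  next
    case False
    then have pl: "p < l * s" using p by simp
    \<comment> \<open>The chord rises from \<open>p\<close>, whereas the claim is linear in
      \<open>u\<close> itself; since \<open>p = s / a\<close>, the shift costs exactly
      \<open>q\<close>. Shortening the denominator to \<open>l * s - p\<close> only steepens the
      chord.\<close>
    have frac: "q * a * u / s - q \<le> q * l * a * ((u - p) / (l * s - p))"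
    proof -
      have "q * a * u / s - q = q * a * (u - p) / s"
        using a0 \<open>0 < s\<close> by (simp add: p_def field_simps)
      also have "\<dots> = q * l * a * ((u - p) / (l * s))"
        using \<open>0 < l\<close> \<open>0 < s\<close> by (simp add: field_simps)
      also have "\<dots> \<le> q * l * a * ((u - p) / (l * s - p))"
        using p pl a0 \<open>0 \<le> q\<close> \<open>0 < l\<close> \<open>0 < s\<close> by (intro mult_left_mono divide_left_mono mult_pos_pos) auto
      finally show ?thesis .
    qed
    have "(l * s - u) * (ln n - B) + (u - p) * (ln n + q * l * a - B)
        \<le> (l * s - u) * cumulative p + (u - p) * cumulative (l * s)"
      using p gp gl by (intro add_mono mult_left_mono) auto
    also have "\<dots> \<le> (l * s - p) * cumulative u"
      using p by (intro cumulative_concave) auto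
    finally have "(l * s - p) * (ln n - B) + (u - p) * (q * l * a) \<le> (l * s - p) * cumulative u"
      by (simp add: algebra_simps)
    then have "ln n - B + q * l * a * ((u - p) / (l * s - p)) \<le> cumulative u"
      using pl by (simp add: field_simps)
    then show ?thesis using frac by linarith
  qed
  then have "ln n - psi D u \<le> 2 * B + q - (q * a / s) * u"
    using B[of u] p by (simp add: psi_eq)
  then have "exp (ln n - psi D u) \<le> exp (2 * B + q - (q * a / s) * u)"
    by simp
  moreover have "exp (ln n - psi D u) = n * tail D u"
    using n by (simp add: tail_eq_exp exp_diff exp_minus divide_inverse)
  ultimately show ?thesis
    by (simp add: exp_diff exp_minus divide_inverse)
qed

text \<open>On \<open>{l * s..s}\<close> the rate \<open>\<eta>\<close> is at most
  \<open>K / s\<close>, and the two values of \<open>b\<close> cost \<open>2 * B\<close>. Writing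
  the exponent \<open>K * (s - u) / s\<close> as \<open>K - (K / s) * u\<close> gives the form
  required by \<open>exp_integral_le_of_tail_le\<close>.\<close>

lemma tail_le_exp_near:
  assumes B: "\<And>x. 0 \<le> x \<Longrightarrow> \<bar>b x\<bar> \<le> B"
    and "0 < s" "0 < l" "s * \<eta> (l * s) \<le> K" and u: "l * s \<le> u" "u \<le> s"
  shows "tail D u \<le> tail D s * exp (2 * B + K) * exp (- (K / s) * u)"
proof -
  have u0: "0 < u" using u \<open>0 < s\<close> \<open>0 < l\<close> by (smt (verit) mult_pos_pos)
  have "\<eta> (l * s) \<le> K / s"
    using assms by (simp add: field_simps)
  then have "\<eta> u \<le> K / s"
    using eta_antimono[of "l * s" u] u assms by simp
  then have "(s - u) * \<eta> u \<le> (s - u) * (K / s)"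
    using u by (intro mult_left_mono) auto
  then have "psi D s - psi D u \<le> 2 * B + (s - u) * (K / s)"
    using psi_diff_le[OF u0 u(2)] B[of s] B[of u] u0 \<open>0 < s\<close> by linarith
  then have "- psi D u \<le> - psi D s + (2 * B + K) + - (K / s) * u"
    using \<open>0 < s\<close> by (simp add: field_simps)
  then have "exp (- psi D u) \<le> exp (- psi D s + (2 * B + K) + - (K / s) * u)"
    by (rule exp_le_cancel_iff[THEN iffD2])
  then show ?thesis
    by (simp only: tail_eq_exp exp_add)
qed

text \<open>A shift by \<open>\<rho> * r\<close> changes \<open>psi D\<close> by at most
  \<open>\<delta>\<close>, half from \<open>b\<close> and half from the integral. The first half
  uses that the ratio of the arguments is within \<open>\<rho>\<close> of 1, the second that
  \<open>r * \<eta> (l * s) \<le> 1\<close>.\<close>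

lemma tail_insensitive:
  assumes "0 < l" "l < 1" "0 < \<delta>"
  shows "\<exists>\<rho>>0. \<exists>T>0. \<rho> < 1 - l \<and> (\<forall>s\<ge>T. \<forall>r. 0 \<le> r \<longrightarrow> r \<le> s \<longrightarrow> r * \<eta> (l * s) \<le> 1 \<longrightarrow>
    tail D (s - \<rho> * r) \<le> exp \<delta> * tail D s \<and> exp (- \<delta>) * tail D s \<le> tail D (s + \<rho> * r))"
proof -
  have lim: "((\<lambda>(y, t). b (y * t) - b t) \<longlongrightarrow> 0) (nhds 1 \<times>\<^sub>F at_top)"
    using representation by (simp add: psi_representation_def)
  have "\<forall>\<^sub>F z in nhds 1 \<times>\<^sub>F at_top. dist (case z of (y, t) \<Rightarrow> b (y * t) - b t) 0 < \<delta> / 2"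
    using lim by (rule tendstoD) (use \<open>0 < \<delta>\<close> in simp)
  \<comment> \<open>The product filter provides one neighbourhood of 1 and one threshold that serve
    all pairs simultaneously; hence the estimate is uniform in \<open>r\<close>.\<close>
  then obtain P Q where P: "eventually P (nhds (1::real))" and Q: "eventually Q (at_top :: real filter)"
    and PQ: "\<And>y t. P y \<Longrightarrow> Q t \<Longrightarrow> \<bar>b (y * t) - b t\<bar> < \<delta> / 2"
    by (auto simp: eventually_prod_filter dist_real_def)
  obtain d where d: "0 < d" "\<And>y. \<bar>y - 1\<bar> < d \<Longrightarrow> P y"
    using P by (auto simp: eventually_nhds_metric dist_real_def)
  obtain T0 where T0: "\<And>t. T0 \<le> t \<Longrightarrow> Q t"
    using Q by (auto simp: eventually_at_top_linorder)
  \<comment> \<open>The three bounds keep the ratio inside the neighbourhood where \<open>b\<close>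
    varies little, keep \<open>s - \<rho> * r\<close> above \<open>l * s\<close>, and limit the
    contribution of the integral to \<open>\<delta> / 2\<close>.\<close>
  define \<rho> where "\<rho> = min (d / 2) (min ((1 - l) / 2) (\<delta> / 2))"
  have \<rho>: "0 < \<rho>" "\<rho> < d" "\<rho> < 1 - l" "\<rho> \<le> \<delta> / 2"
    using d(1) assms by (auto simp: \<rho>_def min_def)
  have "tail D (s - \<rho> * r) \<le> exp \<delta> * tail D s \<and> exp (- \<delta>) * tail D s \<le> tail D (s + \<rho> * r)"
    if s: "max T0 1 \<le> s" and r: "0 \<le> r" "r \<le> s" and r\<eta>: "r * \<eta> (l * s) \<le> 1" for s r
  proof -
    have s0: "0 < s" using s by simp
    have \<rho>r: "0 \<le> \<rho> * r" "\<rho> * r \<le> \<rho> * s"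
      using \<rho> r by (auto intro: mult_left_mono)
    have b_close: "\<bar>b x - b s\<bar> < \<delta> / 2" if "\<bar>x - s\<bar> \<le> \<rho> * r" for x
    proof -
      have "\<bar>x / s - 1\<bar> = \<bar>x - s\<bar> / s"
        using s0 by (simp add: field_simps)
      also have "\<dots> \<le> \<rho>"
        using that \<rho>r s0 by (simp add: field_simps)
      finally have "P (x / s)" using d \<rho> by simp
      from PQ[OF this T0, of s] show ?thesis using s s0 by simp
    qed
    have step: "\<rho> * r * \<eta> x \<le> \<delta> / 2" if "l * s \<le> x" for x
    proof -
      have "r * \<eta> x \<le> r * \<eta> (l * s)"
        using that assms s0 r by (intro mult_left_mono eta_antimono) auto
      then have "r * \<eta> x \<le> 1" using r\<eta> by simp
      then have "\<rho> * (r * \<eta> x) \<le> \<rho> * 1"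
        using \<rho> by (intro mult_left_mono) auto
      then show ?thesis using \<rho>(4) unfolding mult.assoc by linarith
    qed
    have "\<rho> * s \<le> (1 - l) * s"
      using \<rho> s0 by (intro mult_right_mono) auto
    then have low: "l * s \<le> s - \<rho> * r"
      using \<rho>r by (simp add: algebra_simps)
    have "0 < l * s" using assms s0 by simp
    then have low0: "0 < s - \<rho> * r" using low by linarith
    have ls: "l * s \<le> s" using assms s0 by simp
    have "psi D s - psi D (s - \<rho> * r) \<le> b s - b (s - \<rho> * r) + (s - (s - \<rho> * r)) * \<eta> (s - \<rho> * r)"
      by (rule psi_diff_le) (use low0 \<rho>r in auto)
    also have "\<dots> \<le> \<delta>"
    proof -
      have "\<bar>b (s - \<rho> * r) - b s\<bar> < \<delta> / 2"
        by (rule b_close) (use \<rho>r in simp)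
      moreover have "s - (s - \<rho> * r) = \<rho> * r" by simp
      ultimately show ?thesis
        using step[OF low] by (simp only:)
    qed
    finally have 1: "- psi D (s - \<rho> * r) \<le> \<delta> + - psi D s" by simp
    have "psi D (s + \<rho> * r) - psi D s \<le> b (s + \<rho> * r) - b s + (s + \<rho> * r - s) * \<eta> s"
      by (rule psi_diff_le) (use s0 \<rho>r in auto)
    also have "\<dots> \<le> \<delta>"
    proof -
      have "\<bar>b (s + \<rho> * r) - b s\<bar> < \<delta> / 2"
        by (rule b_close) (use \<rho>r in simp)
      moreover have "s + \<rho> * r - s = \<rho> * r" by simp
      ultimately show ?thesis
        using step[OF ls] by (simp only:)
    qed
    finally have 2: "- \<delta> + - psi D s \<le> - psi D (s + \<rho> * r)" by simp
    show ?thesis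
      using 1 2 unfolding tail_eq_exp exp_add[symmetric] by simp
  qed
  moreover have "0 < max T0 1" by simp
  ultimately show ?thesis using \<rho> by blast
qed

section \<open>Truncated exponential moments at the scale of the tail\<close>

lemma min_times_max:
  assumes "0 < u" "0 < s"
  shows "min s (1 / \<eta> u) * max 1 (s * \<eta> u) = s"
  using assms eta_pos[of u] by (auto simp: min_def max_def field_simps)

lemma n_tail_eq: "0 < n \<Longrightarrow> n * tail D s = exp (- a_fun D n s)"
  by (simp add: a_fun_def tail_eq_exp exp_diff exp_minus divide_inverse)

lemma moment_parts:
  fixes n :: nat
  assumes "0 < r" "0 < s" "0 < a"
    and le: "n * ((\<bar>mu1 D w\<bar> + a * mu2 D w / s) / r + cdf D (- w)) \<le> \<epsilon>"
  shows "n * \<bar>mu1 D w\<bar> \<le> \<epsilon> * r" "n * (a * mu2 D w / s) \<le> \<epsilon> * r" "n * cdf D (- w) \<le> \<epsilon>"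
proof -
  have nonneg: "0 \<le> n * \<bar>mu1 D w\<bar>" "0 \<le> n * (a * mu2 D w / s)" "0 \<le> n * cdf D (- w)"
    using assms mu2_nonneg[of w] cdf_nonneg[of "- w"] by (auto intro!: mult_nonneg_nonneg divide_nonneg_nonneg)
  have eq: "n * ((\<bar>mu1 D w\<bar> + a * mu2 D w / s) / r + cdf D (- w))
      = n * \<bar>mu1 D w\<bar> / r + n * (a * mu2 D w / s) / r + n * cdf D (- w)"
    by (simp only: distrib_left add_divide_distrib times_divide_eq_right)
  have "0 \<le> n * \<bar>mu1 D w\<bar> / r" "0 \<le> n * (a * mu2 D w / s) / r"
    using nonneg \<open>0 < r\<close> by (auto intro!: divide_nonneg_nonneg simp del: times_divide_eq_right)
  then have "n * \<bar>mu1 D w\<bar> / r \<le> \<epsilon>" "n * (a * mu2 D w / s) / r \<le> \<epsilon>"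
    using le nonneg unfolding eq by linarith+
  then show "n * \<bar>mu1 D w\<bar> \<le> \<epsilon> * r" "n * (a * mu2 D w / s) \<le> \<epsilon> * r"
    using \<open>0 < r\<close> by (auto simp only: pos_divide_le_eq)
  show "n * cdf D (- w) \<le> \<epsilon>"
    using le nonneg \<open>0 \<le> n * \<bar>mu1 D w\<bar> / r\<close> \<open>0 \<le> n * (a * mu2 D w / s) / r\<close> unfolding eq by linarith
qed

text \<open>The moment generating function is at most \<open>1 + d \<le> exp d\<close>, so it
  remains to bound \<open>n * d\<close>. With exponent \<open>c * a / s\<close> and
  \<open>r / s = 1 / K\<close>, the two moments contribute multiples of
  \<open>\<epsilon> * (a / K)\<close>, the left tail contributes \<open>\<epsilon>\<close>, and the
  range from \<open>s / a\<close> to \<open>l * s\<close> a constant. Powers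
  \<open>k \<le> n\<close> are allowed because both \<open>n\<close> and \<open>n - 1\<close> are
  needed.\<close>

lemma truncated_mgf_power_le:
  fixes n k :: nat and B K a s l c q \<epsilon> :: real
  assumes B: "\<And>x. 0 \<le> x \<Longrightarrow> \<bar>b x\<bar> \<le> B"
    and n: "0 < n" "k \<le> n" and a: "a = a_fun D n s" and "0 < s" "0 < l" "l < 1" "0 < c" "c < q"
    and la: "1 \<le> l * a"
    and K: "K = max 1 (s * \<eta> (l * s))" "q * l * a \<le> a - K"
    and first: "n * tail D (s / a) \<le> 1"
    and w: "s / a \<le> w"
    and moment: "n * ((\<bar>mu1 D w\<bar> + a * mu2 D w / s) / min s (1 / \<eta> (l * s)) + cdf D (- w)) \<le> \<epsilon>"
  shows "(LINT x:{..l * s}|D. exp (c * a / s * x)) ^ k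
    \<le> exp (\<epsilon> * (c + exp c * c\<^sup>2) * (a / K) + \<epsilon> + exp (2 * B + q) * (q / (q - c)))"
proof -
  have a0: "0 < a"
    using la \<open>0 < l\<close> by (smt (verit) mult_nonneg_nonpos)
  define \<theta> where "\<theta> = c * a / s"
  define r where "r = min s (1 / \<eta> (l * s))"
  define p where "p = s / a"
  define J where "J = (LINT x:{p<..l * s}|D. exp (\<theta> * x))"
  \<comment> \<open>The absolute value of \<open>mu1 D w\<close> makes \<open>d\<close> nonnegative,
    so that \<open>k * d\<close> can be enlarged to \<open>n * d\<close>.\<close>
  define d where "d = \<theta> * \<bar>mu1 D w\<bar> + exp c * \<theta>\<^sup>2 * mu2 D w + cdf D (- w) + J"
  have ls: "0 < l * s" using assms by simp
  have r0: "0 < r" using \<open>0 < s\<close> eta_pos[OF ls] by (simp add: r_def)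
  have K1: "1 \<le> K" by (simp add: K)
  have rK: "r / s = 1 / K"
    using min_times_max[OF ls \<open>0 < s\<close>] K1 \<open>0 < s\<close> by (simp add: K(1)[symmetric] r_def[symmetric] field_simps)
  have \<theta>0: "0 < \<theta>" using a0 \<open>0 < c\<close> \<open>0 < s\<close> by (simp add: \<theta>_def)
  have p0: "0 < p" using a0 \<open>0 < s\<close> by (simp add: p_def)
  have pl: "p \<le> l * s"
    using a0 \<open>0 < s\<close> la by (simp add: p_def field_simps)
  have J0: "0 \<le> J"
    unfolding J_def set_lebesgue_integral_def by (rule integral_nonneg_AE) (simp add: indicator_def)
  have d0: "0 \<le> d"
    using \<theta>0 mu2_nonneg[of w] cdf_nonneg[of "- w"] J0 by (simp add: d_def)
  let ?m = "LINT x:{..l * s}|D. exp (\<theta> * x)"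
  have "?m \<le> 1 + \<theta> * mu1 D w + exp c * \<theta>\<^sup>2 * mu2 D w + cdf D (- w) + J"
    unfolding J_def using \<theta>0 p0 w a0 \<open>0 < s\<close>
    by (intro truncated_mgf_le) (auto simp: p_def \<theta>_def)
  moreover have "\<theta> * mu1 D w \<le> \<theta> * \<bar>mu1 D w\<bar>"
    using \<theta>0 by (intro mult_left_mono) auto
  ultimately have "?m \<le> 1 + d" by (simp add: d_def)
  also have "\<dots> \<le> exp d" by (rule exp_ge_add_one_self)
  finally have m: "?m \<le> exp d" .
  have m0: "0 \<le> ?m"
    unfolding set_lebesgue_integral_def by (rule integral_nonneg_AE) (simp add: indicator_def)
  have "?m ^ k \<le> exp d ^ k"
    using m m0 by (rule power_mono)
  also have "\<dots> = exp (k * d)"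
    by (rule exp_of_nat_mult[symmetric])
  also have "\<dots> \<le> exp (n * d)"
    using d0 n by (simp add: mult_right_mono)
  also have "n * d \<le> \<epsilon> * (c + exp c * c\<^sup>2) * (a / K) + \<epsilon> + exp (2 * B + q) * (q / (q - c))"
  proof -
    note parts = moment_parts[OF r0 \<open>0 < s\<close> a0 moment[folded r_def]]
    have "n * (\<theta> * \<bar>mu1 D w\<bar>) = \<theta> * (n * \<bar>mu1 D w\<bar>)" by simp
    also have "\<dots> \<le> \<theta> * (\<epsilon> * r)"
      using parts(1) \<theta>0 by (intro mult_left_mono) auto
    also have "\<dots> = \<epsilon> * c * a * (r / s)" by (simp add: \<theta>_def)
    finally have 1: "n * (\<theta> * \<bar>mu1 D w\<bar>) \<le> \<epsilon> * c * (a / K)" by (simp add: rK)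
    have "n * (exp c * \<theta>\<^sup>2 * mu2 D w) = exp c * c\<^sup>2 * (a / s) * (n * (a * mu2 D w / s))"
      by (simp add: \<theta>_def power2_eq_square)
    also have "\<dots> \<le> exp c * c\<^sup>2 * (a / s) * (\<epsilon> * r)"
      using parts(2) a0 \<open>0 < s\<close> by (intro mult_left_mono) auto
    also have "\<dots> = \<epsilon> * (exp c * c\<^sup>2) * a * (r / s)" by simp
    finally have 2: "n * (exp c * \<theta>\<^sup>2 * mu2 D w) \<le> \<epsilon> * (exp c * c\<^sup>2) * (a / K)"
      by (simp add: rK)
    have 3: "n * J \<le> exp (2 * B + q) * (q / (q - c))"
    proof -
      \<comment> \<open>The decay rate supplied by \<open>n_tail_le_exp\<close>. It exceeds
        \<open>\<theta>\<close> by the fixed ratio \<open>q / c\<close>, so the integral stays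
        bounded: \<open>1 + \<theta> / (\<kappa> - \<theta>) = q / (q - c)\<close>.\<close>
      define \<kappa> where "\<kappa> = q * a / s"
      have \<kappa>: "\<theta> < \<kappa>"
        using \<open>c < q\<close> a0 \<open>0 < s\<close> by (simp add: \<theta>_def \<kappa>_def divide_strict_right_mono)
      have "J \<le> exp (2 * B + q) / n * (exp ((\<theta> - \<kappa>) * p)
          + \<theta> * (exp ((\<theta> - \<kappa>) * (l * s)) - exp ((\<theta> - \<kappa>) * p)) / (\<theta> - \<kappa>))"
        unfolding J_def
      proof (rule exp_integral_le_of_tail_le[OF pl \<theta>0])
        show "\<theta> \<noteq> \<kappa>" using \<kappa> by simp
        fix u assume u: "p \<le> u" "u \<le> l * s"
        have "n * tail D u \<le> exp (2 * B + q) * exp (- (q * a / s) * u)"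
        proof (rule n_tail_le_exp[where l = l and K = K])
          show "\<bar>b x\<bar> \<le> B" if "0 \<le> x" for x by (rule B[OF that])
          show "s * \<eta> (l * s) \<le> K" by (simp add: K)
        qed (use assms u in \<open>simp_all add: p_def\<close>)
        then show "tail D u \<le> exp (2 * B + q) / n * exp (- \<kappa> * u)"
          using n by (simp add: \<kappa>_def field_simps)
      qed
      also have "\<dots> \<le> exp (2 * B + q) / n * (1 + \<theta> / (\<kappa> - \<theta>))"
      proof (intro mult_left_mono add_mono)
        have "(\<theta> - \<kappa>) * p \<le> 0" using \<kappa> p0 by (simp add: mult_nonpos_nonneg)
        then show e1: "exp ((\<theta> - \<kappa>) * p) \<le> 1" by simp
        have "\<theta> * (exp ((\<theta> - \<kappa>) * (l * s)) - exp ((\<theta> - \<kappa>) * p)) / (\<theta> - \<kappa>)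
            = \<theta> * (exp ((\<theta> - \<kappa>) * p) - exp ((\<theta> - \<kappa>) * (l * s))) / (\<kappa> - \<theta>)"
          using \<kappa> by (simp add: divide_simps) (simp add: algebra_simps)
        also have "\<dots> \<le> \<theta> * 1 / (\<kappa> - \<theta>)"
          using e1 \<kappa> \<theta>0 exp_ge_zero[of "(\<theta> - \<kappa>) * (l * s)"]
          by (intro divide_right_mono mult_left_mono) (linarith | simp)+
        finally show "\<theta> * (exp ((\<theta> - \<kappa>) * (l * s)) - exp ((\<theta> - \<kappa>) * p)) / (\<theta> - \<kappa>) \<le> \<theta> / (\<kappa> - \<theta>)"
          by simp
      qed simp
      also have "1 + \<theta> / (\<kappa> - \<theta>) = q / (q - c)"
      proof -
        have "\<kappa> - \<theta> = (q - c) * (a / s)" "\<theta> = c * (a / s)"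
          by (simp_all add: \<kappa>_def \<theta>_def diff_divide_distrib left_diff_distrib)
        then have "\<theta> / (\<kappa> - \<theta>) = c / (q - c)"
          using a0 \<open>0 < s\<close> by simp
        then show ?thesis using \<open>c < q\<close> by (simp add: field_simps)
      qed
      finally have "n * J \<le> n * (exp (2 * B + q) / n * (q / (q - c)))"
        by (rule mult_left_mono) simp
      then show ?thesis using n by simp
    qed
    have "n * d = n * (\<theta> * \<bar>mu1 D w\<bar>) + n * (exp c * \<theta>\<^sup>2 * mu2 D w) + n * cdf D (- w) + n * J"
      by (simp add: d_def algebra_simps)
    also have "\<dots> \<le> \<epsilon> * c * (a / K) + \<epsilon> * (exp c * c\<^sup>2) * (a / K) + \<epsilon> + exp (2 * B + q) * (q / (q - c))"
      using 1 2 3 parts(3) by linarith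
    also have "\<dots> = \<epsilon> * (c + exp c * c\<^sup>2) * (a / K) + \<epsilon> + exp (2 * B + q) * (q / (q - c))"
      by (simp add: algebra_simps)
    finally show ?thesis .
  qed
  finally show ?thesis by (simp add: \<theta>_def)
qed

text \<open>Near \<open>s\<close> the tail decays only at rate \<open>\<kappa> = K / s\<close>,
  slower than \<open>\<theta>\<close>, so the upper endpoint \<open>z\<close> dominates the
  integral. The factor 2 bounds \<open>\<theta> / (\<theta> - \<kappa>)\<close>, which follows from
  \<open>K \<le> a / 4\<close> and \<open>1 < c\<close>; the factor \<open>exp (- a)\<close> is
  \<open>n * tail D s\<close>.\<close>

lemma big_jump_integral_le:
  fixes n :: nat and B K a s l c z :: real
  assumes B: "\<And>x. 0 \<le> x \<Longrightarrow> \<bar>b x\<bar> \<le> B"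
    and n: "0 < n" and a: "a = a_fun D n s" and "0 < s" "0 < l" "1 < c"
    and K: "s * \<eta> (l * s) \<le> K" "K \<le> a / 4" and "1 \<le> K"
    and z: "l * s \<le> z" "z \<le> s"
  shows "n * (LINT x:{l * s<..z}|D. exp (c * a / s * x)) \<le> 2 * exp (2 * B + K - a + (c * a - K) * (z / s))"
proof -
  define \<theta> \<kappa> A where "\<theta> = c * a / s" and "\<kappa> = K / s" and "A = tail D s * exp (2 * B + K)"
  have a0: "0 < a" using \<open>K \<le> a / 4\<close> \<open>1 \<le> K\<close> by linarith
  have "a \<le> c * a" using a0 \<open>1 < c\<close> by simp
  then have half: "c * a \<le> 2 * (c * a - K)" and diff: "0 < c * a - K"
    using K(2) a0 \<open>1 \<le> K\<close> by (simp_all only: right_diff_distrib)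
  have \<theta>0: "0 < \<theta>" using a0 \<open>1 < c\<close> \<open>0 < s\<close> by (simp add: \<theta>_def)
  have \<theta>\<kappa>: "\<theta> - \<kappa> = (c * a - K) / s" by (simp add: \<theta>_def \<kappa>_def diff_divide_distrib)
  then have pos: "0 < \<theta> - \<kappa>" using diff \<open>0 < s\<close> by simp
  have A0: "0 \<le> A" using tail_nonneg by (simp add: A_def)
  have ratio: "1 \<le> \<theta> / (\<theta> - \<kappa>)" "\<theta> / (\<theta> - \<kappa>) \<le> 2"
    unfolding \<theta>\<kappa> using diff half \<open>0 < s\<close> \<open>1 \<le> K\<close> by (auto simp: \<theta>_def field_simps)
  have "(LINT x:{l * s<..z}|D. exp (\<theta> * x)) \<le> A * (exp ((\<theta> - \<kappa>) * (l * s))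
      + \<theta> * (exp ((\<theta> - \<kappa>) * z) - exp ((\<theta> - \<kappa>) * (l * s))) / (\<theta> - \<kappa>))"
  proof (rule exp_integral_le_of_tail_le[OF z(1) \<theta>0])
    show "\<theta> \<noteq> \<kappa>" using pos by simp
    fix u assume u: "l * s \<le> u" "u \<le> z"
    show "tail D u \<le> A * exp (- \<kappa> * u)"
      unfolding A_def \<kappa>_def
      by (rule tail_le_exp_near[OF B]) (use assms u in auto)
  qed
  also have "\<dots> \<le> A * (\<theta> / (\<theta> - \<kappa>) * exp ((\<theta> - \<kappa>) * z))"
  proof (rule mult_left_mono[OF _ A0])
    have "exp ((\<theta> - \<kappa>) * (l * s)) \<le> \<theta> / (\<theta> - \<kappa>) * exp ((\<theta> - \<kappa>) * (l * s))"
      using mult_right_mono[OF ratio(1), of "exp ((\<theta> - \<kappa>) * (l * s))"] by simp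
    then show "exp ((\<theta> - \<kappa>) * (l * s))
        + \<theta> * (exp ((\<theta> - \<kappa>) * z) - exp ((\<theta> - \<kappa>) * (l * s))) / (\<theta> - \<kappa>)
        \<le> \<theta> / (\<theta> - \<kappa>) * exp ((\<theta> - \<kappa>) * z)"
      by (simp add: right_diff_distrib diff_divide_distrib)
  qed
  also have "\<dots> \<le> A * (2 * exp ((\<theta> - \<kappa>) * z))"
    using ratio(2) A0 by (intro mult_left_mono mult_right_mono) auto
  finally have "n * (LINT x:{l * s<..z}|D. exp (\<theta> * x)) \<le> n * (A * (2 * exp ((\<theta> - \<kappa>) * z)))"
    by (rule mult_left_mono) simp
  also have "\<dots> = 2 * ((n * tail D s) * exp (2 * B + K) * exp ((\<theta> - \<kappa>) * z))"
    by (simp add: A_def)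
  also have "n * tail D s = exp (- a)"
    using n_tail_eq[OF n] by (simp add: a)
  also have "exp (- a) * exp (2 * B + K) * exp ((\<theta> - \<kappa>) * z) = exp (2 * B + K - a + (c * a - K) * (z / s))"
    by (simp add: \<theta>\<kappa> flip: exp_add)
  finally show ?thesis by (simp add: \<theta>_def)
qed

text \<open>Unpacks the limits into inequalities uniform in \<open>s \<ge> t n\<close>. An infimum
  below \<open>\<epsilon>\<close> yields a truncation level \<open>w\<close>, which may depend on
  \<open>n\<close> and \<open>s\<close>.\<close>

lemma eventually_conditions:
  assumes t: "filterlim t at_top sequentially"
    and moment: "moment_condition D \<eta> l t" and growth: "growth_condition D \<eta> l t"
    and tl: "tail_condition D \<eta> l t"
    and "0 < \<epsilon>" "0 < N"
  shows "\<forall>\<^sub>F n in sequentially. 0 < n \<and> (\<forall>s\<ge>t n. T \<le> s \<and> 0 < a_fun D n s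
    \<and> N * max 1 (s * \<eta> (l * s)) \<le> a_fun D n s \<and> n * tail D (s / a_fun D n s) \<le> \<epsilon>
    \<and> (\<exists>w\<ge>s / a_fun D n s. n * ((\<bar>mu1 D w\<bar> + a_fun D n s * mu2 D w / s) / min s (1 / \<eta> (l * s))
          + cdf D (- w)) \<le> \<epsilon>))"
proof -
  have "\<forall>\<^sub>F n in sequentially. \<forall>s\<in>{t n..}. (INF w\<in>{s / a_fun D n s..}.
        ereal (real n * ((\<bar>mu1 D w\<bar> + a_fun D n s * mu2 D w / s) / min s (1 / \<eta> (l * s))
                          + cdf D (- w)))) < ereal \<epsilon>"
    using moment \<open>0 < \<epsilon>\<close> unfolding moment_condition_def by (rule SUP_tendsto_zeroD)
  moreover have "\<forall>\<^sub>F n in sequentially. \<forall>s\<in>{t n..}.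
      ereal (real n * max 1 (s * \<eta> (l * s)) * tail D (s / a_fun D n s)) < ereal \<epsilon>"
    using tl \<open>0 < \<epsilon>\<close> unfolding tail_condition_def by (rule SUP_tendsto_zeroD)
  moreover have "\<forall>\<^sub>F n in sequentially. \<forall>s\<ge>t n. 0 < a_fun D n s"
    using growth unfolding growth_condition_def by blast
  \<comment> \<open>The threshold \<open>1 / (exp 1 * N)\<close> anticipates the factor
    \<open>exp 1\<close> lost in \<open>max_one_le_entropy\<close>.\<close>
  moreover have "\<forall>\<^sub>F n in sequentially. \<forall>s\<in>{t n..}.
      ereal (max 1 (s * \<eta> (l * s) * ln (s * \<eta> (l * s))) / a_fun D n s) < ereal (1 / (exp 1 * N))"
    using growth \<open>0 < N\<close> unfolding growth_condition_def
    by (intro SUP_tendsto_zeroD[where S = "\<lambda>n. {t n..}"]) auto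
  moreover have "\<forall>\<^sub>F n in sequentially. T \<le> t n"
    using t by (simp add: filterlim_at_top)
  ultimately show ?thesis
    using eventually_gt_at_top[of 0]
  proof eventually_elim
    case (elim n)
    show ?case
    proof (intro conjI allI impI)
      show "0 < n" by (rule elim)
      fix s assume s: "t n \<le> s"
      let ?a = "a_fun D n s" and ?k = "s * \<eta> (l * s)"
      show "T \<le> s" using elim s by simp
      show a: "0 < ?a" using elim s by simp
      have "max 1 (?k * ln ?k) / ?a < 1 / (exp 1 * N)" using elim s by simp
      then have "N * (exp 1 * max 1 (?k * ln ?k)) \<le> ?a"
        using a \<open>0 < N\<close> by (simp add: field_simps)
      moreover have "N * max 1 ?k \<le> N * (exp 1 * max 1 (?k * ln ?k))"
        using \<open>0 < N\<close> by (intro mult_left_mono max_one_le_entropy) auto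
      ultimately show "N * max 1 ?k \<le> ?a" by linarith
      have "real n * max 1 ?k * tail D (s / ?a) < \<epsilon>" using elim s by simp
      moreover have "real n * 1 * tail D (s / ?a) \<le> real n * max 1 ?k * tail D (s / ?a)"
        using tail_nonneg by (intro mult_right_mono mult_left_mono) auto
      ultimately show "n * tail D (s / ?a) \<le> \<epsilon>" by simp
      have "(INF w\<in>{s / ?a..}. ereal (real n * ((\<bar>mu1 D w\<bar> + ?a * mu2 D w / s) / min s (1 / \<eta> (l * s))
          + cdf D (- w)))) < ereal \<epsilon>"
        using elim s by simp
      then show "\<exists>w\<ge>s / ?a. n * ((\<bar>mu1 D w\<bar> + ?a * mu2 D w / s) / min s (1 / \<eta> (l * s))
          + cdf D (- w)) \<le> \<epsilon>"
        by (auto simp: INF_less_iff intro: less_imp_le)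
    qed
  qed
qed

end

section \<open>The one big jump\<close>

locale iid_hazard = iid_variables M D X I + hazard: hazard_representation D b \<eta>
  for M :: "'a measure" and D :: "real measure" and X :: "'i \<Rightarrow> 'a \<Rightarrow> real" and I :: "'i set"
    and b \<eta> :: "real \<Rightarrow> real"
begin

text \<open>\<open>prob_sum_gt_upper\<close> with \<open>y = l * s\<close>,
  \<open>z = s - \<rho> * r\<close> and \<open>\<theta> = c * a / s\<close>. Each of the three error
  terms becomes \<open>exp (- a)\<close> times an exponential that decays in
  \<open>a / K\<close>.\<close>

lemma sum_tail_ratio_le:
  fixes B K a s l c q \<epsilon> \<rho> :: real
  defines "n \<equiv> card I"
  assumes B: "\<And>x. 0 \<le> x \<Longrightarrow> \<bar>b x\<bar> \<le> B"
    and n: "0 < n" and a: "a = a_fun D n s" and s: "0 < s" and l: "0 < l" "l < 1"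
    and c: "1 < c" "c < q"
    and K: "K = max 1 (s * \<eta> (l * s))" and Ka: "q * l * a \<le> a - K" "K \<le> a / 4" and la: "1 \<le> l * a"
    and first: "n * tail D (s / a) \<le> 1"
    and w: "s / a \<le> w"
    and moment: "n * ((\<bar>mu1 D w\<bar> + a * mu2 D w / s) / min s (1 / \<eta> (l * s)) + cdf D (- w)) \<le> \<epsilon>"
    and \<epsilon>: "0 \<le> \<epsilon>" "\<epsilon> \<le> 1" "\<epsilon> * (c + exp c * c\<^sup>2) \<le> (c - 1) / 2" "\<epsilon> * (c + exp c * c\<^sup>2) \<le> \<rho> / 4"
    and \<rho>: "0 < \<rho>" "\<rho> < 1 - l"
  defines "r \<equiv> min s (1 / \<eta> (l * s))" and "C \<equiv> 1 + exp (2 * B + q) * (q / (q - c))"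
  shows "prob {\<omega> \<in> space M. s < (\<Sum>i\<in>I. X i \<omega>)} \<le> n * tail D (s - \<rho> * r)
    + exp (- a) * (exp (4 * B - (a / K) / 2) + exp (C - (c - 1) / 2 * (a / K))
        + 2 * exp (2 * B + C - \<rho> / 4 * (a / K)))"
proof -
  define \<theta> m J where "\<theta> = c * a / s" and "m = (LINT x:{..l * s}|D. exp (\<theta> * x))"
    and "J = (LINT x:{l * s<..s - \<rho> * r}|D. exp (\<theta> * x))"
  \<comment> \<open>The logarithm of the bound on powers of \<open>m\<close>. The gains to be set
    against it are \<open>(c - 1) * a\<close> without a jump and \<open>\<rho> / 2 * (a / K)\<close>
    with one; the smallness of \<open>\<epsilon>\<close> lets the first summand of \<open>G\<close>
    use up at most half of either.\<close>
  define G where "G = \<epsilon> * (c + exp c * c\<^sup>2) * (a / K) + C"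
  have K1: "1 \<le> K" by (simp add: K)
  then have a0: "0 < a" using Ka(2) by linarith
  have ls: "0 < l * s" using l s by simp
  have r0: "0 < r" "r \<le> s" using s hazard.eta_pos[OF ls] by (auto simp: r_def)
  have rK: "r / s = 1 / K"
    using hazard.min_times_max[OF ls s] K1 s by (simp add: K[symmetric] r_def[symmetric] field_simps)
  have x: "1 \<le> a / K" "a / K \<le> a"
    using K1 a0 Ka(2) by (auto simp: field_simps)
  have "\<rho> * r \<le> (1 - l) * s"
    using \<rho> r0 by (intro mult_mono) auto
  then have zl: "l * s \<le> s - \<rho> * r" by (simp add: algebra_simps)
  have zs: "s - \<rho> * r \<le> s" using \<rho> r0 by simp
  have \<theta>0: "0 \<le> \<theta>" using a0 c s by (simp add: \<theta>_def)
  have m_pow: "m ^ k \<le> exp G" if "k \<le> n" for k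
  proof -
    have "m ^ k \<le> exp (\<epsilon> * (c + exp c * c\<^sup>2) * (a / K) + \<epsilon> + exp (2 * B + q) * (q / (q - c)))"
      unfolding m_def \<theta>_def
      by (rule hazard.truncated_mgf_power_le[OF B n that a s l _ c(2) la K Ka(1) first w moment])
         (use c in auto)
    also have "\<dots> \<le> exp G"
      using \<epsilon> by (simp add: G_def C_def)
    finally show ?thesis .
  qed
  have J0: "0 \<le> J"
    unfolding J_def set_lebesgue_integral_def by (rule integral_nonneg_AE) (simp add: indicator_def)
  have nJ: "n * J \<le> 2 * exp (2 * B + K - a + (c * a - K) * ((s - \<rho> * r) / s))"
    unfolding J_def \<theta>_def
    by (rule hazard.big_jump_integral_le[OF B n a s l(1) c(1) _ Ka(2) K1 zl zs]) (simp_all add: K)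
  have "prob {\<omega> \<in> space M. s < (\<Sum>i\<in>I. X i \<omega>)}
      \<le> n * tail D (s - \<rho> * r) + (n * tail D (l * s))\<^sup>2 + exp (- \<theta> * s) * m ^ n
        + n * (exp (- \<theta> * s) * (J * m ^ (n - 1)))"
    unfolding n_def m_def J_def by (rule prob_sum_gt_upper[OF \<theta>0 zl])
  also have "(n * tail D (l * s))\<^sup>2 \<le> exp (- a) * exp (4 * B - (a / K) / 2)"
  proof -
    have "tail D (l * s) \<le> tail D s * exp (2 * B + K) * exp (- (K / s) * (l * s))"
      by (rule hazard.tail_le_exp_near[OF B s l(1)]) (use l s in \<open>auto simp: K\<close>)
    also have "\<dots> \<le> tail D s * exp (2 * B + K) * 1"
      using law.tail_nonneg K1 s l by (intro mult_left_mono) auto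
    finally have "n * tail D (l * s) \<le> n * (tail D s * exp (2 * B + K) * 1)"
      by (rule mult_left_mono) simp
    also have "\<dots> = exp (- a) * exp (2 * B + K)"
      using hazard.n_tail_eq[OF n, of s] by (simp add: a)
    finally have "(n * tail D (l * s))\<^sup>2 \<le> (exp (- a) * exp (2 * B + K))\<^sup>2"
      using law.tail_nonneg by (intro power_mono) auto
    also have "\<dots> = exp (- a + (4 * B + 2 * K - a))"
      by (simp add: power2_eq_square flip: exp_add)
    also have "\<dots> \<le> exp (- a + (4 * B - (a / K) / 2))"
    proof -
      have "- a + (4 * B + 2 * K - a) \<le> - a + (4 * B - (a / K) / 2)"
        using Ka(2) divide_right_mono[OF x(2), of 2] by linarith
      then show ?thesis by (rule exp_le_cancel_iff[THEN iffD2])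
    qed
    finally show ?thesis by (simp only: exp_add)
  qed
  also have "exp (- \<theta> * s) * m ^ n \<le> exp (- a) * exp (C - (c - 1) / 2 * (a / K))"
  proof -
    have "exp (- \<theta> * s) * m ^ n \<le> exp (- \<theta> * s) * exp G"
      using m_pow[of n] by (intro mult_left_mono) auto
    also have "\<dots> = exp (- a + (G - (c - 1) * a))"
      using s by (simp add: \<theta>_def algebra_simps flip: exp_add)
    also have "\<dots> \<le> exp (- a + (C - (c - 1) / 2 * (a / K)))"
    proof -
      have "\<epsilon> * (c + exp c * c\<^sup>2) * (a / K) \<le> (c - 1) / 2 * (a / K)"
        using \<epsilon>(3) x by (intro mult_right_mono) auto
      moreover have "(c - 1) * (a / K) \<le> (c - 1) * a"
        using c x by (intro mult_left_mono) auto
      moreover have "(c - 1) / 2 * (a / K) = (c - 1) * (a / K) / 2" by simp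
      ultimately have "- a + (G - (c - 1) * a) \<le> - a + (C - (c - 1) / 2 * (a / K))"
        unfolding G_def by linarith
      then show ?thesis by (rule exp_le_cancel_iff[THEN iffD2])
    qed
    finally show ?thesis by (simp only: exp_add)
  qed
  also have "n * (exp (- \<theta> * s) * (J * m ^ (n - 1))) \<le> exp (- a) * (2 * exp (2 * B + C - \<rho> / 4 * (a / K)))"
  proof -
    have "n * (exp (- \<theta> * s) * (J * m ^ (n - 1))) = exp (- \<theta> * s) * ((n * J) * m ^ (n - 1))"
      by simp
    also have "\<dots> \<le> exp (- \<theta> * s) * ((n * J) * exp G)"
      using m_pow[of "n - 1"] J0 by (intro mult_left_mono) auto
    also have "\<dots> \<le> exp (- \<theta> * s) * (2 * exp (2 * B + K - a + (c * a - K) * ((s - \<rho> * r) / s)) * exp G)"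
      using nJ by (intro mult_left_mono mult_right_mono) auto
    also have "\<dots> = 2 * exp (- \<theta> * s + (2 * B + K - a + (c * a - K) * ((s - \<rho> * r) / s)) + G)"
      by (simp only: exp_add mult_ac)
    \<comment> \<open>Since \<open>(s - \<rho> * r) / s = 1 - \<rho> / K\<close>, the terms
      \<open>c * a\<close> and \<open>K\<close> cancel. What remains is the gain from the gap:
      \<open>\<rho> / K\<close> times the difference \<open>c * a - K\<close> of the rescaled
      rates.\<close>
    also have "- \<theta> * s + (2 * B + K - a + (c * a - K) * ((s - \<rho> * r) / s)) + G
        = - a + (2 * B + G - (c * a - K) * (\<rho> / K))"
    proof -
      have "(s - \<rho> * r) / s = 1 - \<rho> * (r / s)"
        using s by (simp add: field_simps)
      then have "(s - \<rho> * r) / s = 1 - \<rho> / K" by (simp add: rK)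
      then have "(c * a - K) * ((s - \<rho> * r) / s) = c * a - K - (c * a - K) * (\<rho> / K)"
        by (simp only: right_diff_distrib mult_1_right)
      moreover have "- \<theta> * s = - (c * a)" using s by (simp add: \<theta>_def)
      ultimately show ?thesis by linarith
    qed
    also have "2 * exp (- a + (2 * B + G - (c * a - K) * (\<rho> / K)))
        \<le> 2 * exp (- a + (2 * B + C - \<rho> / 4 * (a / K)))"
    proof -
      have "\<epsilon> * (c + exp c * c\<^sup>2) * (a / K) \<le> \<rho> / 4 * (a / K)"
        using \<epsilon>(4) x by (intro mult_right_mono) auto
      moreover have "a / 2 * (\<rho> / K) \<le> (c * a - K) * (\<rho> / K)"
      proof (rule mult_right_mono)
        have "a \<le> c * a" using a0 c by simp
        then show "a / 2 \<le> c * a - K" using Ka(2) a0 by linarith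
      qed (use \<rho> K1 in simp)
      moreover have "a / 2 * (\<rho> / K) = 2 * (\<rho> / 4 * (a / K))" by simp
      ultimately have "- a + (2 * B + G - (c * a - K) * (\<rho> / K)) \<le> - a + (2 * B + C - \<rho> / 4 * (a / K))"
        unfolding G_def by linarith
      then show ?thesis by simp
    qed
    finally show ?thesis by (simp only: exp_add mult.left_commute)
  qed
  finally show ?thesis by (simp add: distrib_left)
qed

text \<open>\<open>prob_sum_gt_lower\<close> with gap \<open>\<rho> * r\<close>, the remaining sum
  being controlled by \<open>prob_sum_le_neg\<close>. The hypothesis \<open>K \<le> a\<close>
  amounts to \<open>s \<le> r * a\<close>, which turns the bound on
  \<open>n * (a * mu2 D w / s)\<close> into \<open>n * mu2 D w \<le> \<epsilon> * r\<^sup>2\<close>,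
  the scale required by Chebyshev's inequality.\<close>

lemma sum_tail_ratio_ge:
  fixes a s l \<epsilon> \<rho> :: real
  defines "n \<equiv> card I"
  assumes n: "0 < n" and s: "0 < s" and l: "0 < l" and a: "0 < a"
    and Ka: "max 1 (s * \<eta> (l * s)) \<le> a"
    and first: "n * tail D (s / a) \<le> \<epsilon>"
    and w: "s / a \<le> w"
    and moment: "n * ((\<bar>mu1 D w\<bar> + a * mu2 D w / s) / min s (1 / \<eta> (l * s)) + cdf D (- w)) \<le> \<epsilon>"
    and \<epsilon>: "0 \<le> \<epsilon>" "\<epsilon> \<le> 1"
    and \<rho>: "0 < \<rho>"
  defines "v \<equiv> s + \<rho> * min s (1 / \<eta> (l * s))"
  shows "n * tail D v * (1 - (2 * \<epsilon> + 2 * \<epsilon> / \<rho>\<^sup>2) - n * tail D v) \<le> prob {\<omega> \<in> space M. s < (\<Sum>i\<in>I. X i \<omega>)}"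
proof -
  define r where "r = min s (1 / \<eta> (l * s))"
  have ls: "0 < l * s" using l s by simp
  have r0: "0 < r" using s hazard.eta_pos[OF ls] by (auto simp: r_def)
  have w0: "0 < w" using w a s by (smt (verit) divide_pos_pos)
  have s_le: "s \<le> r * a"
    using mult_left_mono[OF Ka, of r] r0 hazard.min_times_max[OF ls s] by (simp add: r_def)
  note parts = hazard.moment_parts[OF r0 s a moment[folded r_def]]
  show ?thesis
    unfolding n_def v_def r_def[symmetric]
  proof (rule prob_sum_gt_lower)
    fix i assume i: "i \<in> I"
    define k where "k = card (I - {i})"
    have k: "k \<le> n" unfolding k_def n_def by (intro card_mono finite_I) auto
    have "prob {\<omega> \<in> space M. (\<Sum>j\<in>I - {i}. X j \<omega>) \<le> - (\<rho> * r)}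
        \<le> k * (cdf D (- w) + tail D w) + (k * mu2 D w + (k * mu1 D w)\<^sup>2) / (\<rho> * r)\<^sup>2"
      unfolding k_def using w0 \<rho> r0 by (intro prob_sum_le_neg) auto
    also have "k * (cdf D (- w) + tail D w) \<le> 2 * \<epsilon>"
    proof -
      have "k * (cdf D (- w) + tail D w) \<le> n * (cdf D (- w) + tail D w)"
        using k law.cdf_nonneg law.tail_nonneg by (intro mult_right_mono) auto
      also have "\<dots> \<le> n * cdf D (- w) + n * tail D (s / a)"
        using law.tail_antimono[OF w] by (simp add: distrib_left mult_left_mono)
      finally show ?thesis using parts(3) first by linarith
    qed
    also have "(k * mu2 D w + (k * mu1 D w)\<^sup>2) / (\<rho> * r)\<^sup>2 \<le> 2 * \<epsilon> / \<rho>\<^sup>2"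
    proof -
      have "k * mu2 D w \<le> n * mu2 D w"
        using k law.mu2_nonneg by (intro mult_right_mono) auto
      also have "\<dots> \<le> \<epsilon> * r\<^sup>2"
      proof -
        have "n * mu2 D w = n * (a * mu2 D w / s) * (s / a)"
          using a s by simp
        also have "\<dots> \<le> \<epsilon> * r * (s / a)"
          using parts(2) a s by (intro mult_right_mono) auto
        also have "\<dots> \<le> \<epsilon> * r * r"
          using s_le a \<epsilon> r0 by (intro mult_left_mono) (auto simp: field_simps)
        finally show ?thesis by (simp add: power2_eq_square mult.assoc)
      qed
      finally have 1: "k * mu2 D w \<le> \<epsilon> * r\<^sup>2" .
      have "k * \<bar>mu1 D w\<bar> \<le> n * \<bar>mu1 D w\<bar>"
        using k by (intro mult_right_mono) auto
      then have "k * \<bar>mu1 D w\<bar> \<le> \<epsilon> * r" using parts(1) by linarith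
      then have "(k * \<bar>mu1 D w\<bar>)\<^sup>2 \<le> (\<epsilon> * r)\<^sup>2"
        by (intro power_mono) auto
      also have "\<dots> \<le> \<epsilon> * r\<^sup>2"
        using mult_right_mono[OF mult_left_le[OF \<epsilon>(2) \<epsilon>(1)], of "r\<^sup>2"]
        by (simp add: power_mult_distrib power2_eq_square mult_ac)
      finally have "(k * mu1 D w)\<^sup>2 \<le> \<epsilon> * r\<^sup>2"
        by (simp add: power_mult_distrib)
      with 1 have "(k * mu2 D w + (k * mu1 D w)\<^sup>2) / (\<rho> * r)\<^sup>2 \<le> (2 * \<epsilon> * r\<^sup>2) / (\<rho> * r)\<^sup>2"
        by (intro divide_right_mono) auto
      also have "\<dots> = 2 * \<epsilon> / \<rho>\<^sup>2"
        using r0 by (simp add: power_mult_distrib)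
      finally show ?thesis .
    qed
    finally show "prob {\<omega> \<in> space M. (\<Sum>j\<in>I - {i}. X j \<omega>) \<le> - (\<rho> * r)} \<le> 2 * \<epsilon> + 2 * \<epsilon> / \<rho>\<^sup>2"
      by simp
  qed
qed

end

section \<open>Choice of constants and uniform convergence\<close>

lemma exp_affine_tendsto_zero:
  fixes A k :: real
  assumes "0 < k"
  shows "((\<lambda>x. exp (A - k * x)) \<longlongrightarrow> 0) at_top"
proof -
  have "filterlim (\<lambda>x. k * x) at_top at_top"
    by (rule filterlim_tendsto_pos_mult_at_top[OF tendsto_const assms filterlim_ident])
  then have "filterlim (\<lambda>x. - (k * x)) at_bot at_top"
    by (simp add: filterlim_uminus_at_top)
  then have "((\<lambda>x. exp (- (k * x))) \<longlongrightarrow> 0) at_top"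
    by (rule filterlim_compose[OF exp_at_bot])
  then have "((\<lambda>x. exp A * exp (- (k * x))) \<longlongrightarrow> 0) at_top"
    by (rule tendsto_mult_right_zero)
  then show ?thesis by (simp add: exp_diff exp_minus divide_inverse)
qed

theorem theorem2p1:
  fixes M :: "'a measure" and X :: "nat \<Rightarrow> 'a \<Rightarrow> real" and D :: "real measure"
    and b \<eta> :: "real \<Rightarrow> real" and t :: "nat \<Rightarrow> real" and l :: real
  assumes "prob_space M"
    and "real_distribution D"
    and "prob_space.indep_vars M (\<lambda>_. borel) X {1..}"
    and "\<And>i. i \<ge> 1 \<Longrightarrow> distr M borel (X i) = D"
    and "\<And>x. tail D x > 0"
    and "psi_representation D b \<eta>"
    and "mono_on {1..} t" and "filterlim t at_top sequentially"
    and "0 < l" and "l < 1"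
    and "moment_condition D \<eta> l t"
    and "growth_condition D \<eta> l t"
    and "tail_condition D \<eta> l t"
  shows "(\<lambda>n. SUP s\<in>{t n..}.
           ereal \<bar>measure M {\<omega> \<in> space M. (\<Sum>i=1..n. X i \<omega>) > s} / (real n * tail D s) - 1\<bar>)
         \<longlonglongrightarrow> 0"
proof (rule SUP_tendsto_zeroI)
  fix \<zeta> :: real assume \<zeta>: "0 < \<zeta>" "\<zeta> \<le> 1"
  interpret prob_space M by fact
  interpret law: real_distribution D by fact
  interpret hazard: hazard_representation D b \<eta>
    by unfold_locales (fact assms)+
  obtain B where B: "\<And>x. 0 \<le> x \<Longrightarrow> \<bar>b x\<bar> \<le> B"
    using hazard.b_bounded by blast
  have l: "0 < l" "l < 1" by fact+
  have inv_l: "1 < 1 / l" using l by simp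
  \<comment> \<open>\<open>c > 1\<close> makes the exponent beat \<open>exp (- a)\<close>,
    \<open>q > c\<close> leaves the middle range summable, and \<open>q * l < 1\<close> leaves room
    to absorb \<open>K\<close>.\<close>
  obtain c where c: "1 < c" "c < 1 / l" using dense[OF inv_l] by blast
  obtain q where q: "c < q" "q < 1 / l" using dense[OF c(2)] by blast
  have ql: "q * l < 1" using q l by (simp add: field_simps)
  \<comment> \<open>Chosen so that the insensitivity of the tail costs a factor between
    \<open>1 - \<zeta> / 2\<close> and \<open>1 + \<zeta> / 2\<close>.\<close>
  define \<delta> where "\<delta> = ln (1 + \<zeta> / 2)"
  have \<delta>: "0 < \<delta>" "exp \<delta> = 1 + \<zeta> / 2" using \<zeta> by (simp_all add: \<delta>_def)
  have "(1 - \<zeta> / 2) * (1 + \<zeta> / 2) \<le> 1"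
    by (simp add: algebra_simps)
  then have exp_m\<delta>: "1 - \<zeta> / 2 \<le> exp (- \<delta>)"
    using \<delta> \<zeta> by (simp add: exp_minus field_simps)
  obtain \<rho> T where \<rho>: "0 < \<rho>" "\<rho> < 1 - l" and T: "0 < T"
    and insens: "\<And>s r. T \<le> s \<Longrightarrow> 0 \<le> r \<Longrightarrow> r \<le> s \<Longrightarrow> r * \<eta> (l * s) \<le> 1 \<Longrightarrow>
      tail D (s - \<rho> * r) \<le> exp \<delta> * tail D s \<and> exp (- \<delta>) * tail D s \<le> tail D (s + \<rho> * r)"
    using hazard.tail_insensitive[OF l \<delta>(1)] by metis
  define C where "C = 1 + exp (2 * B + q) * (q / (q - c))"
  \<comment> \<open>The relative error of \<open>sum_tail_ratio_le\<close> as a function of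
    \<open>x = a / K\<close>.\<close>
  define h where "h x = exp (4 * B - x / 2) + exp (C - (c - 1) / 2 * x) + 2 * exp (2 * B + C - \<rho> / 4 * x)"
    for x :: real
  have "((\<lambda>x. exp (4 * B - 1 / 2 * x) + exp (C - (c - 1) / 2 * x) + 2 * exp (2 * B + C - \<rho> / 4 * x))
      \<longlongrightarrow> 0 + 0 + 2 * 0) at_top"
    using c \<rho> by (intro tendsto_intros exp_affine_tendsto_zero) auto
  then have "(h \<longlongrightarrow> 0) at_top" by (simp add: h_def[abs_def])
  then have "\<forall>\<^sub>F x in at_top. h x < \<zeta> / 2"
    by (rule order_tendstoD) (use \<zeta> in simp)
  moreover have "\<forall>\<^sub>F x in at_top. exp (0 - 1 * x) < \<zeta> / 4"
    by (rule order_tendstoD[OF exp_affine_tendsto_zero]) (use \<zeta> in simp_all)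
  ultimately have "\<forall>\<^sub>F x in at_top. h x < \<zeta> / 2 \<and> exp (- x) < \<zeta> / 4"
    by eventually_elim simp
  then obtain N0 where N0: "\<And>x. N0 \<le> x \<Longrightarrow> h x < \<zeta> / 2 \<and> exp (- x) < \<zeta> / 4"
    by (auto simp: eventually_at_top_linorder)
  \<comment> \<open>A lower bound for \<open>a / K\<close>: \<open>N0\<close> makes the errors
    small, 4 gives \<open>K \<le> a / 4\<close>, \<open>1 / (1 - q * l)\<close> gives
    \<open>q * l * a \<le> a - K\<close>, and \<open>1 / l\<close> gives
    \<open>1 \<le> l * a\<close>.\<close>
  define N where "N = max N0 (max 4 (max (1 / (1 - q * l)) (1 / l)))"
  have N: "N0 \<le> N" "4 \<le> N" "1 / (1 - q * l) \<le> N" "1 / l \<le> N"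
    by (simp_all add: N_def)
  define C2 where "C2 = c + exp c * c\<^sup>2"
  have C2: "0 < C2" using c by (simp add: C2_def add_pos_nonneg)
  \<comment> \<open>The two quotients by \<open>C2\<close> keep the moment terms below half of the
    exponential gains; the last bound keeps the Chebyshev error of \<open>sum_tail_ratio_ge\<close>
    below \<open>\<zeta> / 4\<close>.\<close>
  define \<epsilon> where "\<epsilon> = min 1 (min ((c - 1) / 2 / C2) (min (\<rho> / 4 / C2) (\<zeta> / 4 / (2 + 2 / \<rho>\<^sup>2))))"
  have den: "0 < 2 + 2 / \<rho>\<^sup>2" using \<rho> by (simp add: add_pos_pos)
  have \<epsilon>0: "0 < \<epsilon>" "\<epsilon> \<le> 1" using c \<rho> C2 \<zeta> den by (simp_all add: \<epsilon>_def)
  have "\<epsilon> \<le> (c - 1) / 2 / C2" "\<epsilon> \<le> \<rho> / 4 / C2" "\<epsilon> \<le> \<zeta> / 4 / (2 + 2 / \<rho>\<^sup>2)"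
    by (simp_all only: \<epsilon>_def min.cobounded1 min.cobounded2 min.coboundedI2 min.coboundedI1)
  then have "\<epsilon> * C2 \<le> (c - 1) / 2" "\<epsilon> * C2 \<le> \<rho> / 4" and \<epsilon>2': "\<epsilon> * (2 + 2 / \<rho>\<^sup>2) \<le> \<zeta> / 4"
    by (simp_all only: pos_le_divide_eq[OF C2] pos_le_divide_eq[OF den])
  then have \<epsilon>1: "\<epsilon> * (c + exp c * c\<^sup>2) \<le> (c - 1) / 2" "\<epsilon> * (c + exp c * c\<^sup>2) \<le> \<rho> / 4"
    by (simp_all only: C2_def)
  have \<epsilon>2: "2 * \<epsilon> + 2 * \<epsilon> / \<rho>\<^sup>2 \<le> \<zeta> / 4"
    using \<epsilon>2' by (simp add: algebra_simps)
  have "0 < N" using N by simp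
  from hazard.eventually_conditions[OF assms(8,11,12,13) \<epsilon>0(1) this, of T]
  show "\<forall>\<^sub>F n in sequentially. \<forall>s\<in>{t n..}.
      \<bar>measure M {\<omega> \<in> space M. (\<Sum>i=1..n. X i \<omega>) > s} / (real n * tail D s) - 1\<bar> \<le> \<zeta>"
  proof eventually_elim
    case (elim n)
    then have n: "0 < n" by simp
    interpret S: iid_hazard M D X "{1..n}" b \<eta>
    proof unfold_locales
      show "indep_vars (\<lambda>_. borel) X {1..n}"
        using assms(3) by (rule indep_vars_subset) auto
    qed (use assms(4) in auto)
    show ?case
    proof
      fix s assume "s \<in> {t n..}"
      define a where "a = a_fun D n s"
      define K where "K = max 1 (s * \<eta> (l * s))"
      define r where "r = min s (1 / \<eta> (l * s))"
      let ?P = "prob {\<omega> \<in> space M. s < (\<Sum>i=1..n. X i \<omega>)}"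
      from elim \<open>s \<in> {t n..}\<close> have Ts: "T \<le> s" and a0: "0 < a" and NK: "N * K \<le> a"
        and first: "n * tail D (s / a) \<le> \<epsilon>"
        and "\<exists>w\<ge>s / a. n * ((\<bar>mu1 D w\<bar> + a * mu2 D w / s) / min s (1 / \<eta> (l * s)) + cdf D (- w)) \<le> \<epsilon>"
        by (auto simp: a_def K_def)
      then obtain w where w: "s / a \<le> w"
        and moment: "n * ((\<bar>mu1 D w\<bar> + a * mu2 D w / s) / min s (1 / \<eta> (l * s)) + cdf D (- w)) \<le> \<epsilon>"
        by blast
      have s: "0 < s" using Ts T by simp
      have K1: "1 \<le> K" by (simp add: K_def)
      have NaK: "N \<le> a / K" using NK K1 by (simp add: field_simps)
      have K4: "K \<le> a / 4"
      proof -
        have "4 * K \<le> N * K" using N(2) K1 by (intro mult_right_mono) auto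
        then show ?thesis using NK by linarith
      qed
      have K_le: "max 1 (s * \<eta> (l * s)) \<le> a"
        using K4 a0 unfolding K_def by linarith
      have Kq: "q * l * a \<le> a - K"
      proof -
        have "1 / (1 - q * l) * K \<le> a"
          using order_trans[OF mult_right_mono[OF N(3), of K] NK] K1 by simp
        then have "K \<le> (1 - q * l) * a" using ql by (simp add: field_simps)
        then show ?thesis by (simp add: algebra_simps)
      qed
      have aK: "a / K \<le> a" using K1 a0 by (simp add: field_simps)
      have la: "1 \<le> l * a"
      proof -
        have "1 / l \<le> a" using N(4) NaK aK by linarith
        then show ?thesis using l by (simp add: field_simps)
      qed
      have ls: "0 < l * s" using l s by simp
      have r: "0 \<le> r" "r \<le> s" "r * \<eta> (l * s) \<le> 1"
        using s hazard.eta_pos[OF ls] by (auto simp: r_def min_def field_simps)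
      note ins = insens[OF Ts r]
      have nt: "n * tail D s = exp (- a)"
        using hazard.n_tail_eq[OF n] by (simp add: a_def)
      have aK0: "N0 \<le> a / K" using N(1) NaK by linarith
      have small: "h (a / K) < \<zeta> / 2" "exp (- (a / K)) < \<zeta> / 4"
        using N0[OF aK0] by auto
      have "?P \<le> n * tail D (s - \<rho> * r) + exp (- a) * h (a / K)"
        using S.sum_tail_ratio_le[of B a s l c q K w \<epsilon> \<rho>] B n s l c q K4 Kq la first w moment \<epsilon>0 \<epsilon>1 \<rho>
        by (simp add: a_def K_def r_def h_def C_def)
      also have "n * tail D (s - \<rho> * r) \<le> exp (- a) * (1 + \<zeta> / 2)"
      proof -
        have "n * tail D (s - \<rho> * r) \<le> n * (exp \<delta> * tail D s)"
          using ins by (intro mult_left_mono) auto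
        also have "\<dots> = n * tail D s * (1 + \<zeta> / 2)"
          by (simp add: \<delta>(2))
        finally show ?thesis unfolding nt .
      qed
      also have "exp (- a) * h (a / K) \<le> exp (- a) * (\<zeta> / 2)"
        using small by (intro mult_left_mono) auto
      finally have upper: "?P \<le> exp (- a) * (1 + \<zeta>)"
        by (simp add: algebra_simps)
      define v where "v = s + \<rho> * r"
      have vs: "s \<le> v" using \<rho> r by (simp add: v_def)
      have "n * tail D v \<le> exp (- a)"
        using mult_left_mono[OF law.tail_antimono[OF vs], of "real n"] nt by simp
      also have "\<dots> \<le> exp (- (a / K))" using aK by simp
      finally have v_small: "n * tail D v \<le> \<zeta> / 4" using small by simp
      have v_ge: "exp (- a) * (1 - \<zeta> / 2) \<le> n * tail D v"
      proof -
        have "exp (- a) * (1 - \<zeta> / 2) \<le> exp (- a) * exp (- \<delta>)"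
          using exp_m\<delta> by simp
        also have "\<dots> = n * (exp (- \<delta>) * tail D s)"
          unfolding nt[symmetric] by simp
        also have "\<dots> \<le> n * tail D v"
          using ins unfolding v_def by (intro mult_left_mono) auto
        finally show ?thesis .
      qed
      \<comment> \<open>One factor \<open>1 - \<zeta> / 2\<close> pays for moving the level from
        \<open>s\<close> to \<open>v\<close>, the other for the Chebyshev error and the double
        exceedances, each at most \<open>\<zeta> / 4\<close>.\<close>
      have "exp (- a) * (1 - \<zeta>) \<le> exp (- a) * ((1 - \<zeta> / 2) * (1 - \<zeta> / 2))"
        by (intro mult_left_mono) (simp_all add: algebra_simps)
      also have "\<dots> = exp (- a) * (1 - \<zeta> / 2) * (1 - \<zeta> / 2)"
        by simp
      also have "\<dots> \<le> n * tail D v * (1 - (2 * \<epsilon> + 2 * \<epsilon> / \<rho>\<^sup>2) - n * tail D v)"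
        using v_small \<epsilon>2 \<zeta> law.tail_nonneg by (intro mult_mono[OF v_ge]) auto
      also have "\<dots> \<le> ?P"
        using S.sum_tail_ratio_ge[of s l a \<epsilon> w \<rho>] n s l a0 K_le first w moment \<epsilon>0 \<rho>
        by (simp add: K_def v_def r_def)
      finally have lower: "exp (- a) * (1 - \<zeta>) \<le> ?P" .
      have "?P / exp (- a) \<le> 1 + \<zeta>" "1 - \<zeta> \<le> ?P / exp (- a)"
        using upper lower by (simp_all only: pos_divide_le_eq pos_le_divide_eq exp_gt_zero mult.commute)
      then show "\<bar>?P / (real n * tail D s) - 1\<bar> \<le> \<zeta>"
        unfolding nt by (simp only: abs_le_iff) linarith
    qed
  qed
qed auto

end
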